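(* Let $\mathcal{P}$ be an additive category, and assume $\operatorname{mod}(\mathcal{P})$ is an abelian category. Let $\mathcal{X}$ be a subcategory of $\operatorname{mod}(\mathcal{P})$ closed under extensions and kernels of deflations, and which contains $\Upsilon(\mathcal{P})$. Then $$\operatorname{mod}_{\mathsf{adm}}(\mathcal{X})=\{F\in\operatorname{mod}(\mathcal{X})\mid F|_{\mathcal{P}}\in\mathcal{X}\}.$$
   Context: All categories are essentially small; subcategories are full and closed under isomorphisms. For an additive category $\mathcal{C}$, $\operatorname{mod}(\mathcal{C})$ is the category of additive contravariant functors $F\colon\mathcal{C}\to\mathsf{Ab}$ admitting an exact sequence $\operatorname{Hom}_{\mathcal{C}}(-,X)\to\operatorname{Hom}_{\mathcal{C}}(-,Y)\to F\to0$, and $\Upsilon\colon\mathcal{C}\to\operatorname{mod}(\mathcal{C})$, $\Upsilon(X)=\operatorname{Hom}_{\mathcal{C}}(-,X)$, is the Yoneda embedding; $\Upsilon(\mathcal{P})$ is the subcategory of objects isomorphic to some $\Upsilon(P)$. The deflations of the abelian category $\operatorname{mod}(\mathcal{P})$ are the epimorphisms; closed under kernels of deflations means that the kernel of any epimorphism of $\operatorname{mod}(\mathcal{P})$ between objects of $\mathcal{X}$ lies in $\mathcal{X}$. As an extension-closed subcategory, $\mathcal{X}$ is an exact category (in the sense of Quillen) with the exact structure inherited from $\operatorname{mod}(\mathcal{P})$. $\operatorname{mod}_{\mathsf{adm}}(\mathcal{X})$ is the full subcategory of $\operatorname{mod}(\mathcal{X})$ of functors $F$ admitting an exact sequence $\operatorname{Hom}_{\mathcal{X}}(-,X)\xrightarrow{\operatorname{Hom}_{\mathcal{X}}(-,f)}\operatorname{Hom}_{\mathcal{X}}(-,Y)\to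 F\to 0$ with $f$ admissible in $\mathcal{X}$, i.e. $f=m\circ p$ with $m$ an inflation and $p$ a deflation in $\mathcal{X}$. For $F\in\operatorname{mod}(\mathcal{X})$, $F|_{\mathcal{P}}$ is the restriction of $F$ along $\Upsilon\colon\mathcal{P}\to\mathcal{X}$, i.e. the functor $P\mapsto F(\Upsilon(P))$ on $\mathcal{P}$. *)

theory Defs
  imports "HOL-Algebra.Coset"
begin

section \<open>Preadditive, additive and abelian categories\<close>

text \<open>
  Morphism sets are abelian groups in the sense of \<^locale>\<open>comm_group\<close>, so the sum of two
  morphisms is written as a product and the zero morphism is the unit of the group.
  Morphism sets of different pairs of objects need not be disjoint; for this reason composition
  takes the three objects as arguments:
  \<open>Comp C X Y Z g f\<close> is the composite of \<open>f : X \<rightarrow> Y\<close> and \<open>g : Y \<rightarrow> Z\<close>.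
\<close>

record ('o, 'a) precat =
  Obj :: "'o set"
  Hom :: "'o \<Rightarrow> 'o \<Rightarrow> 'a monoid"
  Ident :: "'o \<Rightarrow> 'a"
  Comp :: "'o \<Rightarrow> 'o \<Rightarrow> 'o \<Rightarrow> 'a \<Rightarrow> 'a \<Rightarrow> 'a"

abbreviation Arr :: "('o, 'a) precat \<Rightarrow> 'o \<Rightarrow> 'o \<Rightarrow> 'a set"
  where "Arr C X Y \<equiv> carrier (Hom C X Y)"

abbreviation Zero :: "('o, 'a) precat \<Rightarrow> 'o \<Rightarrow> 'o \<Rightarrow> 'a"
  where "Zero C X Y \<equiv> \<one>\<^bsub>Hom C X Y\<^esub>"

locale preadditive_category =
  fixes C :: "('o, 'a) precat"
  assumes hom_group: "\<lbrakk>X \<in> Obj C; Y \<in> Obj C\<rbrakk> \<Longrightarrow> comm_group (Hom C X Y)"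
    and ident_closed: "X \<in> Obj C \<Longrightarrow> Ident C X \<in> Arr C X X"
    and comp_hom_right:
      "\<lbrakk>X \<in> Obj C; Y \<in> Obj C; Z \<in> Obj C; g \<in> Arr C Y Z\<rbrakk>
        \<Longrightarrow> (\<lambda>f. Comp C X Y Z g f) \<in> hom (Hom C X Y) (Hom C X Z)"
    and comp_hom_left:
      "\<lbrakk>X \<in> Obj C; Y \<in> Obj C; Z \<in> Obj C; f \<in> Arr C X Y\<rbrakk>
        \<Longrightarrow> (\<lambda>g. Comp C X Y Z g f) \<in> hom (Hom C Y Z) (Hom C X Z)"
    and comp_ident_right:
      "\<lbrakk>X \<in> Obj C; Y \<in> Obj C; f \<in> Arr C X Y\<rbrakk> \<Longrightarrow> Comp C X X Y f (Ident C X) = f"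
    and comp_ident_left:
      "\<lbrakk>X \<in> Obj C; Y \<in> Obj C; f \<in> Arr C X Y\<rbrakk> \<Longrightarrow> Comp C X Y Y (Ident C Y) f = f"
    and comp_assoc:
      "\<lbrakk>W \<in> Obj C; X \<in> Obj C; Y \<in> Obj C; Z \<in> Obj C;
        f \<in> Arr C W X; g \<in> Arr C X Y; h \<in> Arr C Y Z\<rbrakk>
        \<Longrightarrow> Comp C W X Z (Comp C X Y Z h g) f = Comp C W Y Z h (Comp C W X Y g f)"

definition is_zero_object :: "('o, 'a) precat \<Rightarrow> 'o \<Rightarrow> bool"
  where "is_zero_object C Z \<longleftrightarrow> Z \<in> Obj C \<and>
    (\<forall>X\<in>Obj C. Arr C Z X = {Zero C Z X} \<and> Arr C X Z = {Zero C X Z})"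

definition is_biproduct ::
    "('o, 'a) precat \<Rightarrow> 'o \<Rightarrow> 'o \<Rightarrow> 'o \<Rightarrow> 'a \<Rightarrow> 'a \<Rightarrow> 'a \<Rightarrow> 'a \<Rightarrow> bool"
  where "is_biproduct C X Y B i j p q \<longleftrightarrow> B \<in> Obj C \<and>
    i \<in> Arr C X B \<and> j \<in> Arr C Y B \<and> p \<in> Arr C B X \<and> q \<in> Arr C B Y \<and>
    Comp C X B X p i = Ident C X \<and> Comp C Y B Y q j = Ident C Y \<and>
    Comp C Y B X p j = Zero C Y X \<and> Comp C X B Y q i = Zero C X Y \<and>
    Comp C B X B i p \<otimes>\<^bsub>Hom C B B\<^esub> Comp C B Y B j q = Ident C B"

locale additive_category = preadditive_category +
  assumes zero_object: "\<exists>Z. is_zero_object C Z"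
    and biproducts: "\<lbrakk>X \<in> Obj C; Y \<in> Obj C\<rbrakk> \<Longrightarrow> \<exists>B i j p q. is_biproduct C X Y B i j p q"

definition is_isomorphism :: "('o, 'a) precat \<Rightarrow> 'o \<Rightarrow> 'o \<Rightarrow> 'a \<Rightarrow> bool"
  where "is_isomorphism C X Y f \<longleftrightarrow> f \<in> Arr C X Y \<and>
    (\<exists>g\<in>Arr C Y X. Comp C X Y X g f = Ident C X \<and> Comp C Y X Y f g = Ident C Y)"

definition isomorphic :: "('o, 'a) precat \<Rightarrow> 'o \<Rightarrow> 'o \<Rightarrow> bool"
  where "isomorphic C X Y \<longleftrightarrow> (\<exists>f. is_isomorphism C X Y f)"

definition is_mono :: "('o, 'a) precat \<Rightarrow> 'o \<Rightarrow> 'o \<Rightarrow> 'a \<Rightarrow> bool"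
  where "is_mono C X Y f \<longleftrightarrow> f \<in> Arr C X Y \<and>
    (\<forall>T\<in>Obj C. \<forall>u\<in>Arr C T X. \<forall>v\<in>Arr C T X. Comp C T X Y f u = Comp C T X Y f v \<longrightarrow> u = v)"

definition is_epi :: "('o, 'a) precat \<Rightarrow> 'o \<Rightarrow> 'o \<Rightarrow> 'a \<Rightarrow> bool"
  where "is_epi C X Y f \<longleftrightarrow> f \<in> Arr C X Y \<and>
    (\<forall>T\<in>Obj C. \<forall>u\<in>Arr C Y T. \<forall>v\<in>Arr C Y T. Comp C X Y T u f = Comp C X Y T v f \<longrightarrow> u = v)"

text \<open>\<open>k : K \<rightarrow> X\<close> is a kernel, respectively \<open>c : Y \<rightarrow> Q\<close> a cokernel, of \<open>f : X \<rightarrow> Y\<close>.\<close>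

definition is_kernel :: "('o, 'a) precat \<Rightarrow> 'o \<Rightarrow> 'o \<Rightarrow> 'a \<Rightarrow> 'o \<Rightarrow> 'a \<Rightarrow> bool"
  where "is_kernel C X Y f K k \<longleftrightarrow>
    f \<in> Arr C X Y \<and> K \<in> Obj C \<and> k \<in> Arr C K X \<and> Comp C K X Y f k = Zero C K Y \<and>
    (\<forall>T\<in>Obj C. \<forall>t\<in>Arr C T X. Comp C T X Y f t = Zero C T Y \<longrightarrow>
      (\<exists>!u. u \<in> Arr C T K \<and> Comp C T K X k u = t))"

definition is_cokernel :: "('o, 'a) precat \<Rightarrow> 'o \<Rightarrow> 'o \<Rightarrow> 'a \<Rightarrow> 'o \<Rightarrow> 'a \<Rightarrow> bool"
  where "is_cokernel C X Y f Q c \<longleftrightarrow>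
    f \<in> Arr C X Y \<and> Q \<in> Obj C \<and> c \<in> Arr C Y Q \<and> Comp C X Y Q c f = Zero C X Q \<and>
    (\<forall>T\<in>Obj C. \<forall>t\<in>Arr C Y T. Comp C X Y T t f = Zero C X T \<longrightarrow>
      (\<exists>!u. u \<in> Arr C Q T \<and> Comp C Y Q T u c = t))"

locale abelian_category = additive_category +
  assumes kernels:
      "\<lbrakk>X \<in> Obj C; Y \<in> Obj C; f \<in> Arr C X Y\<rbrakk> \<Longrightarrow> \<exists>K k. is_kernel C X Y f K k"
    and cokernels:
      "\<lbrakk>X \<in> Obj C; Y \<in> Obj C; f \<in> Arr C X Y\<rbrakk> \<Longrightarrow> \<exists>Q c. is_cokernel C X Y f Q c"
    and mono_is_kernel:
      "\<lbrakk>X \<in> Obj C; Y \<in> Obj C; is_mono C X Y f\<rbrakk> \<Longrightarrow> \<exists>Z\<in>Obj C. \<exists>g. is_kernel C Y Z g X f"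
    and epi_is_cokernel:
      "\<lbrakk>X \<in> Obj C; Y \<in> Obj C; is_epi C X Y f\<rbrakk> \<Longrightarrow> \<exists>W\<in>Obj C. \<exists>g. is_cokernel C W X g Y f"


section \<open>Subcategories and exact structures\<close>

definition full_subcat :: "('o, 'a) precat \<Rightarrow> 'o set \<Rightarrow> ('o, 'a) precat"
  where "full_subcat C S = C\<lparr>Obj := S\<rparr>"

definition iso_closed :: "('o, 'a) precat \<Rightarrow> 'o set \<Rightarrow> bool"
  where "iso_closed C S \<longleftrightarrow> (\<forall>X\<in>S. \<forall>Y\<in>Obj C. isomorphic C X Y \<longrightarrow> Y \<in> S)"

text \<open>A short exact sequence \<open>0 \<rightarrow> X \<rightarrow> Y \<rightarrow> Z \<rightarrow> 0\<close> with maps \<open>i\<close> and \<open>p\<close>.\<close>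

definition short_exact :: "('o, 'a) precat \<Rightarrow> 'o \<Rightarrow> 'o \<Rightarrow> 'o \<Rightarrow> 'a \<Rightarrow> 'a \<Rightarrow> bool"
  where "short_exact C X Y Z i p \<longleftrightarrow>
    Y \<in> Obj C \<and> is_kernel C Y Z p X i \<and> is_cokernel C X Y i Z p"

definition extension_closed :: "('o, 'a) precat \<Rightarrow> 'o set \<Rightarrow> bool"
  where "extension_closed C S \<longleftrightarrow>
    (\<forall>X Y Z i p. short_exact C X Y Z i p \<longrightarrow> X \<in> S \<longrightarrow> Z \<in> S \<longrightarrow> Y \<in> S)"

definition closed_under_kernels_of_epis :: "('o, 'a) precat \<Rightarrow> 'o set \<Rightarrow> bool"
  where "closed_under_kernels_of_epis C S \<longleftrightarrow>
    (\<forall>Y\<in>S. \<forall>Z\<in>S. \<forall>p K k. is_epi C Y Z p \<longrightarrow> is_kernel C Y Z p K k \<longrightarrow> K \<in> S)"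

text \<open>
  An exact structure is given by its conflations: \<open>E X Y Z i p\<close> says that
  \<open>X \<rightarrow> Y \<rightarrow> Z\<close> with maps \<open>i\<close> and \<open>p\<close> is a conflation.
\<close>

type_synonym ('o, 'a) exact_structure = "'o \<Rightarrow> 'o \<Rightarrow> 'o \<Rightarrow> 'a \<Rightarrow> 'a \<Rightarrow> bool"

definition inherited_exact_structure ::
    "('o, 'a) precat \<Rightarrow> 'o set \<Rightarrow> ('o, 'a) exact_structure"
  where "inherited_exact_structure C S X Y Z i p \<longleftrightarrow>
    X \<in> S \<and> Y \<in> S \<and> Z \<in> S \<and> short_exact C X Y Z i p"

definition inflation :: "('o, 'a) exact_structure \<Rightarrow> 'o \<Rightarrow> 'o \<Rightarrow> 'a \<Rightarrow> bool"
  where "inflation E X Y i \<longleftrightarrow> (\<exists>Z p. E X Y Z i p)"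

definition deflation :: "('o, 'a) exact_structure \<Rightarrow> 'o \<Rightarrow> 'o \<Rightarrow> 'a \<Rightarrow> bool"
  where "deflation E Y Z p \<longleftrightarrow> (\<exists>X i. E X Y Z i p)"

definition admissible ::
    "('o, 'a) precat \<Rightarrow> ('o, 'a) exact_structure \<Rightarrow> 'o \<Rightarrow> 'o \<Rightarrow> 'a \<Rightarrow> bool"
  where "admissible C E X Y f \<longleftrightarrow>
    (\<exists>I\<in>Obj C. \<exists>p m. deflation E X I p \<and> inflation E I Y m \<and> f = Comp C X I Y m p)"


section \<open>Finitely presented functors\<close>

text \<open>
  Contravariant functors to abelian groups whose underlying sets are subsets of the type \<open>'v\<close>.
  For \<open>f : X \<rightarrow> Y\<close> the map \<open>on_arr F X Y f\<close> goes from \<open>on_obj F Y\<close> to \<open>on_obj F X\<close>.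
\<close>

record ('o, 'a, 'v) presheaf =
  on_obj :: "'o \<Rightarrow> 'v monoid"
  on_arr :: "'o \<Rightarrow> 'o \<Rightarrow> 'a \<Rightarrow> 'v \<Rightarrow> 'v"

definition additive_presheaf :: "('o, 'a) precat \<Rightarrow> ('o, 'a, 'v) presheaf \<Rightarrow> bool"
  where "additive_presheaf C F \<longleftrightarrow>
    (\<forall>X\<in>Obj C. comm_group (on_obj F X)) \<and>
    (\<forall>X\<in>Obj C. \<forall>Y\<in>Obj C. \<forall>f\<in>Arr C X Y. on_arr F X Y f \<in> hom (on_obj F Y) (on_obj F X)) \<and>
    (\<forall>X\<in>Obj C. \<forall>x\<in>carrier (on_obj F X). on_arr F X X (Ident C X) x = x) \<and>
    (\<forall>X\<in>Obj C. \<forall>Y\<in>Obj C. \<forall>Z\<in>Obj C. \<forall>f\<in>Arr C X Y. \<forall>g\<in>Arr C Y Z.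
      \<forall>z\<in>carrier (on_obj F Z).
        on_arr F X Z (Comp C X Y Z g f) z = on_arr F X Y f (on_arr F Y Z g z)) \<and>
    (\<forall>X\<in>Obj C. \<forall>Y\<in>Obj C. \<forall>f\<in>Arr C X Y. \<forall>g\<in>Arr C X Y. \<forall>y\<in>carrier (on_obj F Y).
        on_arr F X Y (f \<otimes>\<^bsub>Hom C X Y\<^esub> g) y = on_arr F X Y f y \<otimes>\<^bsub>on_obj F X\<^esub> on_arr F X Y g y)"

text \<open>
  The components of a natural transformation are required to take the value
  \<^const>\<open>undefined\<close> outside their domains, so that natural transformations which agree on all
  objects of \<open>C\<close> are equal.
\<close>

definition nat_trans ::
    "('o, 'a) precat \<Rightarrow> ('o, 'a, 'v) presheaf \<Rightarrow> ('o, 'a, 'w) presheaf \<Rightarrow> ('o \<Rightarrow> 'v \<Rightarrow> 'w) set"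
  where "nat_trans C F G = {\<eta> \<in> extensional (Obj C).
    (\<forall>X\<in>Obj C. \<eta> X \<in> hom (on_obj F X) (on_obj G X) \<inter> extensional (carrier (on_obj F X))) \<and>
    (\<forall>X\<in>Obj C. \<forall>Y\<in>Obj C. \<forall>f\<in>Arr C X Y. \<forall>y\<in>carrier (on_obj F Y).
      \<eta> X (on_arr F X Y f y) = on_arr G X Y f (\<eta> Y y))}"

definition naturally_isomorphic ::
    "('o, 'a) precat \<Rightarrow> ('o, 'a, 'v) presheaf \<Rightarrow> ('o, 'a, 'w) presheaf \<Rightarrow> bool"
  where "naturally_isomorphic C F G \<longleftrightarrow>
    (\<exists>\<eta>\<in>nat_trans C F G. \<forall>X\<in>Obj C. \<eta> X \<in> iso (on_obj F X) (on_obj G X))"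

definition yoneda :: "('o, 'a) precat \<Rightarrow> 'o \<Rightarrow> ('o, 'a, 'a) presheaf"
  where "yoneda C X =
    \<lparr>on_obj = (\<lambda>W. Hom C W X), on_arr = (\<lambda>V W f g. Comp C V W X g f)\<rparr>"

definition yoneda_arr :: "('o, 'a) precat \<Rightarrow> 'o \<Rightarrow> 'o \<Rightarrow> 'a \<Rightarrow> ('o \<Rightarrow> 'a \<Rightarrow> 'a)"
  where "yoneda_arr C X Y f = (\<lambda>W\<in>Obj C. \<lambda>g\<in>Arr C W X. Comp C W X Y f g)"

text \<open>Pointwise exactness of \<open>F \<rightarrow> G \<rightarrow> H \<rightarrow> 0\<close>.\<close>

definition right_exact ::
    "('o, 'a) precat \<Rightarrow> ('o, 'a, 'u) presheaf \<Rightarrow> ('o, 'a, 'v) presheaf \<Rightarrow> ('o, 'a, 'w) presheaf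
      \<Rightarrow> ('o \<Rightarrow> 'u \<Rightarrow> 'v) \<Rightarrow> ('o \<Rightarrow> 'v \<Rightarrow> 'w) \<Rightarrow> bool"
  where "right_exact C F G H \<alpha> \<beta> \<longleftrightarrow>
    \<alpha> \<in> nat_trans C F G \<and> \<beta> \<in> nat_trans C G H \<and>
    (\<forall>W\<in>Obj C. \<alpha> W ` carrier (on_obj F W) = kernel (on_obj G W) (on_obj H W) (\<beta> W) \<and>
      \<beta> W ` carrier (on_obj G W) = carrier (on_obj H W))"

definition presented_by ::
    "('o, 'a) precat \<Rightarrow> 'o \<Rightarrow> 'o \<Rightarrow> 'a \<Rightarrow> ('o, 'a, 'v) presheaf \<Rightarrow> bool"
  where "presented_by C X Y f F \<longleftrightarrow>
    (\<exists>\<pi>. right_exact C (yoneda C X) (yoneda C Y) F (yoneda_arr C X Y f) \<pi>)"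

text \<open>
  The objects of \<open>mod(C)\<close> with values in \<open>'v\<close>. If \<open>'v\<close> is the type \<open>'a\<close> of morphisms of
  \<open>C\<close>, then every finitely presented functor is isomorphic to one of these: its values are
  quotients of morphism groups, which can be realised on sets of representatives.
\<close>

definition fp_functors :: "('o, 'a) precat \<Rightarrow> ('o, 'a, 'v) presheaf set"
  where "fp_functors C = {F. additive_presheaf C F \<and>
    (\<exists>X\<in>Obj C. \<exists>Y\<in>Obj C. \<exists>f\<in>Arr C X Y. presented_by C X Y f F)}"

definition mod_cat :: "('o, 'a) precat \<Rightarrow> (('o, 'a, 'a) presheaf, 'o \<Rightarrow> 'a \<Rightarrow> 'a) precat"
  where "mod_cat C =
    \<lparr>Obj = fp_functors C,
     Hom = (\<lambda>F G.
       \<lparr>carrier = nat_trans C F G,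
        mult = (\<lambda>\<eta> \<theta>. \<lambda>X\<in>Obj C. \<lambda>x\<in>carrier (on_obj F X). \<eta> X x \<otimes>\<^bsub>on_obj G X\<^esub> \<theta> X x),
        one = (\<lambda>X\<in>Obj C. \<lambda>x\<in>carrier (on_obj F X). \<one>\<^bsub>on_obj G X\<^esub>)\<rparr>),
     Ident = (\<lambda>F. \<lambda>X\<in>Obj C. \<lambda>x\<in>carrier (on_obj F X). x),
     Comp = (\<lambda>F G H \<theta> \<eta>. \<lambda>X\<in>Obj C. compose (carrier (on_obj F X)) (\<theta> X) (\<eta> X))\<rparr>"

definition mod_adm ::
    "('o, 'a) precat \<Rightarrow> ('o, 'a) exact_structure \<Rightarrow> ('o, 'a, 'v) presheaf set"
  where "mod_adm C E = {F \<in> fp_functors C.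
    \<exists>X\<in>Obj C. \<exists>Y\<in>Obj C. \<exists>f\<in>Arr C X Y. admissible C E X Y f \<and> presented_by C X Y f F}"

definition representables :: "('o, 'a) precat \<Rightarrow> ('o, 'a, 'a) presheaf set"
  where "representables C =
    {F \<in> Obj (mod_cat C). \<exists>X\<in>Obj C. isomorphic (mod_cat C) F (yoneda C X)}"

text \<open>The restriction of a functor along the Yoneda embedding.\<close>

definition restrict_yoneda ::
    "('o, 'a) precat \<Rightarrow> (('o, 'a, 'a) presheaf, 'o \<Rightarrow> 'a \<Rightarrow> 'a, 'v) presheaf
      \<Rightarrow> ('o, 'a, 'v) presheaf"
  where "restrict_yoneda C F =
    \<lparr>on_obj = (\<lambda>W. on_obj F (yoneda C W)),
     on_arr = (\<lambda>V W f. on_arr F (yoneda C V) (yoneda C W) (yoneda_arr C V W f))\<rparr>"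

text \<open>
  Membership of a functor in an isomorphism-closed class \<open>S\<close> of functors. Membership is tested up
  to isomorphism because the values of \<open>F\<close> may live in another type than those of the members
  of \<open>S\<close>.
\<close>

definition belongs_to ::
    "('o, 'a) precat \<Rightarrow> ('o, 'a, 'v) presheaf \<Rightarrow> ('o, 'a, 'w) presheaf set \<Rightarrow> bool"
  where "belongs_to C F S \<longleftrightarrow> (\<exists>G\<in>S. naturally_isomorphic C F G)"

end

theory Submission imports Defs
begin

text \<open>
  If \<open>F\<close> is presented by \<open>f : X \<rightarrow> Y\<close> in \<open>\<X>\<close>, evaluating the presentation at representable functors
  and using the Yoneda lemma identifies \<open>F|\<^sub>\<P>\<close> with the cokernel of \<open>f\<close> in \<open>mod(\<P>)\<close>. If \<open>f = m \<circ> p\<close>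
  is admissible, this cokernel is the third term of the conflation that starts with \<open>m\<close>.
  Conversely, if the cokernel \<open>G\<close> of \<open>f\<close> lies in \<open>\<X>\<close>, then so does the kernel \<open>I\<close> of \<open>Y \<rightarrow> G\<close>, which is
  the image of \<open>f\<close>, and hence also the kernel of \<open>X \<rightarrow> I\<close>; so \<open>f\<close> is admissible. All exactness
  statements are checked pointwise, which is possible because kernels and epimorphisms in
  \<open>mod(\<P>)\<close> are pointwise.
\<close>

section \<open>Presheaves and natural transformations\<close>

lemma nat_transI:
  assumes "\<eta> \<in> extensional (Obj C)"
    and "\<And>X. X \<in> Obj C \<Longrightarrow> \<eta> X \<in> hom (on_obj F X) (on_obj G X)"
    and "\<And>X. X \<in> Obj C \<Longrightarrow> \<eta> X \<in> extensional (carrier (on_obj F X))"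
    and "\<And>X Y f y. \<lbrakk>X \<in> Obj C; Y \<in> Obj C; f \<in> Arr C X Y; y \<in> carrier (on_obj F Y)\<rbrakk>
      \<Longrightarrow> \<eta> X (on_arr F X Y f y) = on_arr G X Y f (\<eta> Y y)"
  shows "\<eta> \<in> nat_trans C F G"
  using assms unfolding nat_trans_def by blast

lemma nat_trans_hom:
  "\<lbrakk>\<eta> \<in> nat_trans C F G; X \<in> Obj C\<rbrakk> \<Longrightarrow> \<eta> X \<in> hom (on_obj F X) (on_obj G X)"
  unfolding nat_trans_def by blast

lemma nat_trans_closed:
  "\<lbrakk>\<eta> \<in> nat_trans C F G; X \<in> Obj C; x \<in> carrier (on_obj F X)\<rbrakk>
    \<Longrightarrow> \<eta> X x \<in> carrier (on_obj G X)"
  using nat_trans_hom by (rule hom_in_carrier)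

lemma nat_trans_mult:
  "\<lbrakk>\<eta> \<in> nat_trans C F G; X \<in> Obj C; x \<in> carrier (on_obj F X); y \<in> carrier (on_obj F X)\<rbrakk>
    \<Longrightarrow> \<eta> X (x \<otimes>\<^bsub>on_obj F X\<^esub> y) = \<eta> X x \<otimes>\<^bsub>on_obj G X\<^esub> \<eta> X y"
  using nat_trans_hom by (rule hom_mult)

lemma nat_trans_natural:
  "\<lbrakk>\<eta> \<in> nat_trans C F G; X \<in> Obj C; Y \<in> Obj C; f \<in> Arr C X Y; y \<in> carrier (on_obj F Y)\<rbrakk>
    \<Longrightarrow> \<eta> X (on_arr F X Y f y) = on_arr G X Y f (\<eta> Y y)"
  unfolding nat_trans_def by blast

text \<open>Off \<open>Obj C\<close> and off the carriers both sides are \<open>undefined\<close>,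
  so only genuine arguments have to be compared. Nearly every identity between morphisms of
  \<open>mod_cat C\<close> is reduced to elements this way.\<close>

lemma nat_trans_eqI:
  assumes \<eta>: "\<eta> \<in> nat_trans C F G" and \<theta>: "\<theta> \<in> nat_trans C F G"
    and eq: "\<And>X x. \<lbrakk>X \<in> Obj C; x \<in> carrier (on_obj F X)\<rbrakk> \<Longrightarrow> \<eta> X x = \<theta> X x"
  shows "\<eta> = \<theta>"
proof (rule extensionalityI)
  show "\<eta> \<in> extensional (Obj C)" "\<theta> \<in> extensional (Obj C)"
    using \<eta> \<theta> unfolding nat_trans_def by blast+
  fix X assume X: "X \<in> Obj C"
  show "\<eta> X = \<theta> X"
  proof (rule extensionalityI)
    show "\<eta> X \<in> extensional (carrier (on_obj F X))" "\<theta> X \<in> extensional (carrier (on_obj F X))"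
      using \<eta> \<theta> X unfolding nat_trans_def by blast+
  qed (rule eq[OF X])
qed

lemma additive_presheaf_group:
  "\<lbrakk>additive_presheaf C F; X \<in> Obj C\<rbrakk> \<Longrightarrow> comm_group (on_obj F X)"
  unfolding additive_presheaf_def by blast

lemma additive_presheaf_hom:
  "\<lbrakk>additive_presheaf C F; X \<in> Obj C; Y \<in> Obj C; f \<in> Arr C X Y\<rbrakk>
    \<Longrightarrow> on_arr F X Y f \<in> hom (on_obj F Y) (on_obj F X)"
  unfolding additive_presheaf_def by blast

lemma additive_presheaf_closed:
  "\<lbrakk>additive_presheaf C F; X \<in> Obj C; Y \<in> Obj C; f \<in> Arr C X Y; y \<in> carrier (on_obj F Y)\<rbrakk>
    \<Longrightarrow> on_arr F X Y f y \<in> carrier (on_obj F X)"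
  using additive_presheaf_hom by (rule hom_in_carrier)

lemma additive_presheaf_ident:
  "\<lbrakk>additive_presheaf C F; X \<in> Obj C; x \<in> carrier (on_obj F X)\<rbrakk>
    \<Longrightarrow> on_arr F X X (Ident C X) x = x"
  unfolding additive_presheaf_def by blast

lemma additive_presheaf_comp:
  "\<lbrakk>additive_presheaf C F; X \<in> Obj C; Y \<in> Obj C; Z \<in> Obj C; f \<in> Arr C X Y; g \<in> Arr C Y Z;
    z \<in> carrier (on_obj F Z)\<rbrakk>
    \<Longrightarrow> on_arr F X Z (Comp C X Y Z g f) z = on_arr F X Y f (on_arr F Y Z g z)"
  unfolding additive_presheaf_def by blast

lemma additive_presheaf_add:
  "\<lbrakk>additive_presheaf C F; X \<in> Obj C; Y \<in> Obj C; f \<in> Arr C X Y; g \<in> Arr C X Y;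
    y \<in> carrier (on_obj F Y)\<rbrakk>
    \<Longrightarrow> on_arr F X Y (f \<otimes>\<^bsub>Hom C X Y\<^esub> g) y = on_arr F X Y f y \<otimes>\<^bsub>on_obj F X\<^esub> on_arr F X Y g y"
  unfolding additive_presheaf_def by blast

lemma fp_functors_additive: "F \<in> fp_functors C \<Longrightarrow> additive_presheaf C F"
  unfolding fp_functors_def by blast

lemma nat_trans_one:
  assumes "\<eta> \<in> nat_trans C F G" "additive_presheaf C F" "additive_presheaf C G" "X \<in> Obj C"
  shows "\<eta> X \<one>\<^bsub>on_obj F X\<^esub> = \<one>\<^bsub>on_obj G X\<^esub>"
  using assms
  by (meson additive_presheaf_group comm_group.axioms(2) hom_one nat_trans_hom)

section \<open>Elementwise description of the operations of \<open>mod_cat\<close>\<close>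

lemma Obj_mod_cat [simp]: "Obj (mod_cat C) = fp_functors C"
  by (simp add: mod_cat_def)

lemma Arr_mod_cat [simp]: "Arr (mod_cat C) F G = nat_trans C F G"
  by (simp add: mod_cat_def)

lemma mod_cat_zero_apply:
  "\<lbrakk>X \<in> Obj C; x \<in> carrier (on_obj F X)\<rbrakk> \<Longrightarrow> Zero (mod_cat C) F G X x = \<one>\<^bsub>on_obj G X\<^esub>"
  by (simp add: mod_cat_def)

lemma mod_cat_ident_apply:
  "\<lbrakk>X \<in> Obj C; x \<in> carrier (on_obj F X)\<rbrakk> \<Longrightarrow> Ident (mod_cat C) F X x = x"
  by (simp add: mod_cat_def)

text \<open>The values of the three presheaves may live in different types, so this is stated for the
  term that \<^const>\<open>mod_cat\<close> uses as composition.\<close>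

lemma nat_trans_comp:
  assumes F: "additive_presheaf C F"
    and \<eta>: "\<eta> \<in> nat_trans C F G" and \<theta>: "\<theta> \<in> nat_trans C G H"
  shows "(\<lambda>X\<in>Obj C. compose (carrier (on_obj F X)) (\<theta> X) (\<eta> X)) \<in> nat_trans C F H"
proof (rule nat_transI)
  fix X assume X: "X \<in> Obj C"
  show "(\<lambda>X\<in>Obj C. compose (carrier (on_obj F X)) (\<theta> X) (\<eta> X)) X
      \<in> hom (on_obj F X) (on_obj H X)"
    using X nat_trans_closed[OF \<eta> X] nat_trans_closed[OF \<theta> X] nat_trans_mult[OF \<eta> X]
      nat_trans_mult[OF \<theta> X] comm_groupE(1)[OF additive_presheaf_group[OF F X]]
    by (auto simp: hom_def compose_def)
next
  fix X Y f y assume A: "X \<in> Obj C" "Y \<in> Obj C" "f \<in> Arr C X Y" "y \<in> carrier (on_obj F Y)"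
  show "(\<lambda>X\<in>Obj C. compose (carrier (on_obj F X)) (\<theta> X) (\<eta> X)) X (on_arr F X Y f y)
      = on_arr H X Y f ((\<lambda>X\<in>Obj C. compose (carrier (on_obj F X)) (\<theta> X) (\<eta> X)) Y y)"
    using A nat_trans_closed[OF \<eta>] nat_trans_natural[OF \<eta>] nat_trans_natural[OF \<theta>]
      additive_presheaf_closed[OF F]
    by (simp add: compose_def)
qed auto


lemma mod_cat_comp_apply:
  "\<lbrakk>X \<in> Obj C; x \<in> carrier (on_obj F X)\<rbrakk>
    \<Longrightarrow> Comp (mod_cat C) F G H \<theta> \<eta> X x = \<theta> X (\<eta> X x)"
  by (simp add: mod_cat_def compose_eq)

lemma mod_cat_comp_closed:
  "\<lbrakk>additive_presheaf C F; \<eta> \<in> nat_trans C F G; \<theta> \<in> nat_trans C G H\<rbrakk>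
    \<Longrightarrow> Comp (mod_cat C) F G H \<theta> \<eta> \<in> nat_trans C F H"
  using nat_trans_comp[of C F \<eta> G \<theta> H] by (simp add: mod_cat_def)

lemma mod_cat_zero_closed:
  assumes F: "additive_presheaf C F" and G: "additive_presheaf C G"
  shows "Zero (mod_cat C) F G \<in> nat_trans C F G"
proof (rule nat_transI)
  fix X assume X: "X \<in> Obj C"
  show "Zero (mod_cat C) F G X \<in> hom (on_obj F X) (on_obj G X)"
    using comm_groupE(1)[OF additive_presheaf_group[OF F X]]
      comm_groupE(2,5)[OF additive_presheaf_group[OF G X]]
    by (auto simp: hom_def mod_cat_zero_apply[OF X])
next
  fix X Y f y assume A: "X \<in> Obj C" "Y \<in> Obj C" "f \<in> Arr C X Y" "y \<in> carrier (on_obj F Y)"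
  show "Zero (mod_cat C) F G X (on_arr F X Y f y)
      = on_arr G X Y f (Zero (mod_cat C) F G Y y)"
    using A additive_presheaf_closed[OF F A] additive_presheaf_hom[OF G A(1-3)]
      additive_presheaf_group[OF G]
    by (simp add: mod_cat_zero_apply) (metis comm_group.axioms(2) hom_one)
qed (auto simp: mod_cat_def)

lemma mod_cat_ident_closed:
  assumes F: "additive_presheaf C F"
  shows "Ident (mod_cat C) F \<in> nat_trans C F F"
proof (rule nat_transI)
  fix X assume X: "X \<in> Obj C"
  show "Ident (mod_cat C) F X \<in> hom (on_obj F X) (on_obj F X)"
    using comm_groupE(1)[OF additive_presheaf_group[OF F X]]
    by (auto simp: hom_def mod_cat_ident_apply[OF X])
qed (use additive_presheaf_closed[OF F] in \<open>auto simp: mod_cat_def\<close>)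

section \<open>Pointwise quotients of a presheaf\<close>

text \<open>Through this criterion the fibres of two maps out of the same presheaf can be compared
  by comparing their kernels.\<close>

lemma nat_trans_eq_iff_kernel:
  assumes \<eta>: "\<eta> \<in> nat_trans C F G" and F: "additive_presheaf C F" and G: "additive_presheaf C G"
    and X: "X \<in> Obj C" and x: "x \<in> carrier (on_obj F X)" and y: "y \<in> carrier (on_obj F X)"
  shows "\<eta> X x = \<eta> X y \<longleftrightarrow>
    x \<otimes>\<^bsub>on_obj F X\<^esub> inv\<^bsub>on_obj F X\<^esub> y \<in> kernel (on_obj F X) (on_obj G X) (\<eta> X)"
proof -
  interpret F: comm_group "on_obj F X" using F X by (rule additive_presheaf_group)
  interpret G: comm_group "on_obj G X" using G X by (rule additive_presheaf_group)
  interpret group_hom "on_obj F X" "on_obj G X" "\<eta> X"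
    by unfold_locales (rule nat_trans_hom[OF \<eta> X])
  have "\<eta> X x \<otimes>\<^bsub>on_obj G X\<^esub> inv\<^bsub>on_obj G X\<^esub> \<eta> X y = \<one>\<^bsub>on_obj G X\<^esub> \<longleftrightarrow> \<eta> X x = \<eta> X y"
    using x y by (metis G.inv_solve_right' G.l_one G.one_closed hom_closed)
  then show ?thesis using x y by (simp add: kernel_def)
qed

text \<open>Each \<open>q\<close> has a preimage under \<open>\<gamma> W\<close>, and by the kernel
  inclusion the value of \<open>\<tau> W\<close> does not depend on which one is taken. Additivity
  and naturality then descend from \<open>\<tau>\<close>. The values of the three presheaves may lie
  in different types.\<close>

lemma nat_trans_factor:
  assumes Y: "additive_presheaf C Y" and Q: "additive_presheaf C Q" and T: "additive_presheaf C T"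
    and \<gamma>: "\<gamma> \<in> nat_trans C Y Q" and \<tau>: "\<tau> \<in> nat_trans C Y T"
    and surj: "\<And>W. W \<in> Obj C \<Longrightarrow> \<gamma> W ` carrier (on_obj Y W) = carrier (on_obj Q W)"
    and ker: "\<And>W. W \<in> Obj C \<Longrightarrow>
      kernel (on_obj Y W) (on_obj Q W) (\<gamma> W) \<subseteq> kernel (on_obj Y W) (on_obj T W) (\<tau> W)"
  obtains u where "u \<in> nat_trans C Q T"
    and "\<And>W y. \<lbrakk>W \<in> Obj C; y \<in> carrier (on_obj Y W)\<rbrakk> \<Longrightarrow> u W (\<gamma> W y) = \<tau> W y"
proof -
  define s where "s W q = (SOME y. y \<in> carrier (on_obj Y W) \<and> \<gamma> W y = q)" for W q
  define u where "u = (\<lambda>W\<in>Obj C. \<lambda>q\<in>carrier (on_obj Q W). \<tau> W (s W q))"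
  have s: "s W q \<in> carrier (on_obj Y W) \<and> \<gamma> W (s W q) = q"
    if "W \<in> Obj C" "q \<in> carrier (on_obj Q W)" for W q
  proof -
    have "\<exists>y. y \<in> carrier (on_obj Y W) \<and> \<gamma> W y = q"
      using surj[OF that(1)] that(2) by (metis imageE)
    then show ?thesis unfolding s_def by (rule someI_ex)
  qed
  have eq: "u W (\<gamma> W y) = \<tau> W y" if W: "W \<in> Obj C" and y: "y \<in> carrier (on_obj Y W)" for W y
  proof -
    have q: "\<gamma> W y \<in> carrier (on_obj Q W)" using \<gamma> W y by (rule nat_trans_closed)
    \<comment> \<open>The chosen preimage and \<open>y\<close> have the same image under
      \<open>\<gamma> W\<close>, so they differ by an element of its kernel, which
      \<open>\<tau> W\<close> kills as well.\<close>
    have "\<tau> W (s W (\<gamma> W y)) = \<tau> W y"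
      using nat_trans_eq_iff_kernel[OF \<gamma> Y Q W conjunct1[OF s[OF W q]] y]
        nat_trans_eq_iff_kernel[OF \<tau> Y T W conjunct1[OF s[OF W q]] y]
        conjunct2[OF s[OF W q]] subsetD[OF ker[OF W]] by metis
    then show ?thesis using W q by (simp add: u_def)
  qed
  have "u \<in> nat_trans C Q T"
  proof (rule nat_transI)
    fix W assume W: "W \<in> Obj C"
    show "u W \<in> hom (on_obj Q W) (on_obj T W)"
    proof (rule homI)
      fix q assume q: "q \<in> carrier (on_obj Q W)"
      then show "u W q \<in> carrier (on_obj T W)"
        using W s[OF W q] nat_trans_closed[OF \<tau> W] by (simp add: u_def)
      fix r assume r: "r \<in> carrier (on_obj Q W)"
      obtain x y where "x \<in> carrier (on_obj Y W)" "q = \<gamma> W x" "y \<in> carrier (on_obj Y W)" "r = \<gamma> W y"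
        using q r surj[OF W] by blast
      then show "u W (q \<otimes>\<^bsub>on_obj Q W\<^esub> r) = u W q \<otimes>\<^bsub>on_obj T W\<^esub> u W r"
        using nat_trans_mult[OF \<gamma> W, symmetric] nat_trans_mult[OF \<tau> W] eq[OF W]
          comm_groupE(1)[OF additive_presheaf_group[OF Y W]] by simp
    qed
  next
    fix V W f q assume A: "V \<in> Obj C" "W \<in> Obj C" "f \<in> Arr C V W" and q: "q \<in> carrier (on_obj Q W)"
    obtain y where y: "y \<in> carrier (on_obj Y W)" "q = \<gamma> W y"
      using q surj[OF A(2)] by blast
    show "u V (on_arr Q V W f q) = on_arr T V W f (u W q)"
      using y A nat_trans_natural[OF \<gamma> A y(1), symmetric] nat_trans_natural[OF \<tau> A y(1)]
        eq[OF A(1) additive_presheaf_closed[OF Y A y(1)]] eq[OF A(2) y(1)] by simp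
  qed (auto simp: u_def)
  then show thesis using eq by (rule that)
qed

text \<open>The factorization \<open>u\<close> of \<open>\<tau>\<close> through
  \<open>\<gamma>\<close> is onto because \<open>\<tau>\<close> is, and injective because an element
  killed by \<open>\<tau>\<close> is already killed by \<open>\<gamma>\<close>.\<close>

lemma naturally_isomorphic_quotients:
  assumes Y: "additive_presheaf C Y" and Q: "additive_presheaf C Q" and T: "additive_presheaf C T"
    and \<gamma>: "\<gamma> \<in> nat_trans C Y Q" and \<tau>: "\<tau> \<in> nat_trans C Y T"
    and surj: "\<And>W. W \<in> Obj C \<Longrightarrow> \<gamma> W ` carrier (on_obj Y W) = carrier (on_obj Q W)"
      "\<And>W. W \<in> Obj C \<Longrightarrow> \<tau> W ` carrier (on_obj Y W) = carrier (on_obj T W)"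
    and ker: "\<And>W. W \<in> Obj C \<Longrightarrow>
      kernel (on_obj Y W) (on_obj Q W) (\<gamma> W) = kernel (on_obj Y W) (on_obj T W) (\<tau> W)"
  shows "naturally_isomorphic C Q T"
proof -
  obtain u where u: "u \<in> nat_trans C Q T"
    and u_eq: "\<And>W y. \<lbrakk>W \<in> Obj C; y \<in> carrier (on_obj Y W)\<rbrakk> \<Longrightarrow> u W (\<gamma> W y) = \<tau> W y"
    using nat_trans_factor[OF Y Q T \<gamma> \<tau> surj(1)] ker by blast
  have "u W \<in> iso (on_obj Q W) (on_obj T W)" if W: "W \<in> Obj C" for W
  proof -
    have "u W ` carrier (on_obj Q W) = carrier (on_obj T W)"
      using surj[OF W] u_eq[OF W] by (metis (no_types, lifting) image_cong image_image)
    moreover have "inj_on (u W) (carrier (on_obj Q W))"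
    proof (rule inj_onI)
      fix q r assume "q \<in> carrier (on_obj Q W)" "r \<in> carrier (on_obj Q W)" and ur: "u W q = u W r"
      then obtain x y where xy: "x \<in> carrier (on_obj Y W)" "q = \<gamma> W x"
          "y \<in> carrier (on_obj Y W)" "r = \<gamma> W y"
        using surj(1)[OF W] by blast
      then show "q = r"
        using ur u_eq[OF W] nat_trans_eq_iff_kernel[OF \<gamma> Y Q W, of x y]
          nat_trans_eq_iff_kernel[OF \<tau> Y T W, of x y] ker[OF W] by simp
    qed
    ultimately show ?thesis
      using nat_trans_hom[OF u W] by (simp add: iso_def bij_betw_def)
  qed
  then show ?thesis using u unfolding naturally_isomorphic_def by blast
qed


section \<open>The Yoneda embedding\<close>

text \<open>This is the transformation out of \<open>yoneda C X\<close> that the Yoneda lemma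
  assigns to the element \<open>x\<close> of \<open>F\<close> at \<open>X\<close>.\<close>

definition yoneda_map ::
    "('o, 'a) precat \<Rightarrow> ('o, 'a, 'v) presheaf \<Rightarrow> 'o \<Rightarrow> 'v \<Rightarrow> ('o \<Rightarrow> 'a \<Rightarrow> 'v)"
  where "yoneda_map C F X x = (\<lambda>W\<in>Obj C. \<lambda>g\<in>Arr C W X. on_arr F W X g x)"

lemma on_obj_yoneda [simp]: "on_obj (yoneda C X) W = Hom C W X"
  by (simp add: yoneda_def)

lemma on_arr_yoneda [simp]: "on_arr (yoneda C X) V W f = (\<lambda>g. Comp C V W X g f)"
  by (simp add: yoneda_def)

lemma yoneda_map_apply:
  "\<lbrakk>W \<in> Obj C; g \<in> Arr C W X\<rbrakk> \<Longrightarrow> yoneda_map C F X x W g = on_arr F W X g x"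
  by (simp add: yoneda_map_def)

lemma yoneda_arr_apply:
  "\<lbrakk>W \<in> Obj C; g \<in> Arr C W X\<rbrakk> \<Longrightarrow> yoneda_arr C X Y f W g = Comp C W X Y f g"
  by (simp add: yoneda_arr_def)

context preadditive_category
begin

lemma comp_closed:
  "\<lbrakk>X \<in> Obj C; Y \<in> Obj C; Z \<in> Obj C; f \<in> Arr C X Y; g \<in> Arr C Y Z\<rbrakk>
    \<Longrightarrow> Comp C X Y Z g f \<in> Arr C X Z"
  using comp_hom_right[of X Y Z g] by (rule hom_in_carrier)

lemma comp_add_right:
  "\<lbrakk>X \<in> Obj C; Y \<in> Obj C; Z \<in> Obj C; f \<in> Arr C X Y; f' \<in> Arr C X Y; g \<in> Arr C Y Z\<rbrakk>
    \<Longrightarrow> Comp C X Y Z g (f \<otimes>\<^bsub>Hom C X Y\<^esub> f') = Comp C X Y Z g f \<otimes>\<^bsub>Hom C X Z\<^esub> Comp C X Y Z g f'"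
  using hom_mult[OF comp_hom_right[of X Y Z g]] by simp

lemma comp_add_left:
  "\<lbrakk>X \<in> Obj C; Y \<in> Obj C; Z \<in> Obj C; f \<in> Arr C X Y; g \<in> Arr C Y Z; g' \<in> Arr C Y Z\<rbrakk>
    \<Longrightarrow> Comp C X Y Z (g \<otimes>\<^bsub>Hom C Y Z\<^esub> g') f = Comp C X Y Z g f \<otimes>\<^bsub>Hom C X Z\<^esub> Comp C X Y Z g' f"
  using hom_mult[OF comp_hom_left[of X Y Z f]] by simp

lemma comp_zero_right:
  "\<lbrakk>X \<in> Obj C; Y \<in> Obj C; Z \<in> Obj C; g \<in> Arr C Y Z\<rbrakk> \<Longrightarrow> Comp C X Y Z g (Zero C X Y) = Zero C X Z"
  using hom_one[OF comp_hom_right[of X Y Z g]] hom_group comm_group.axioms(2) by blast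

lemma comp_zero_left:
  "\<lbrakk>X \<in> Obj C; Y \<in> Obj C; Z \<in> Obj C; f \<in> Arr C X Y\<rbrakk> \<Longrightarrow> Comp C X Y Z (Zero C Y Z) f = Zero C X Z"
  using hom_one[OF comp_hom_left[of X Y Z f]] hom_group comm_group.axioms(2) by blast

lemma yoneda_additive: "X \<in> Obj C \<Longrightarrow> additive_presheaf C (yoneda C X)"
  unfolding additive_presheaf_def
  by (simp add: hom_group comp_hom_left comp_ident_right comp_assoc comp_add_right)

lemma yoneda_arr_nat_trans:
  assumes "X \<in> Obj C" "Y \<in> Obj C" "f \<in> Arr C X Y"
  shows "yoneda_arr C X Y f \<in> nat_trans C (yoneda C X) (yoneda C Y)"
proof (rule nat_transI)
  fix W assume W: "W \<in> Obj C"
  show "yoneda_arr C X Y f W \<in> hom (on_obj (yoneda C X) W) (on_obj (yoneda C Y) W)"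
    using W assms comm_groupE(1)[OF hom_group[OF W assms(1)]]
    by (intro homI) (simp_all add: yoneda_arr_apply comp_closed comp_add_right)
next
  fix V W g y assume "V \<in> Obj C" "W \<in> Obj C" "g \<in> Arr C V W" "y \<in> carrier (on_obj (yoneda C X) W)"
  then show "yoneda_arr C X Y f V (on_arr (yoneda C X) V W g y)
      = on_arr (yoneda C Y) V W g (yoneda_arr C X Y f W y)"
    using assms by (simp add: yoneda_arr_apply comp_closed comp_assoc)
qed (auto simp: yoneda_arr_def)

lemma yoneda_map_nat_trans:
  assumes F: "additive_presheaf C F" and X: "X \<in> Obj C" and x: "x \<in> carrier (on_obj F X)"
  shows "yoneda_map C F X x \<in> nat_trans C (yoneda C X) F"
proof (rule nat_transI)
  fix W assume W: "W \<in> Obj C"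
  show "yoneda_map C F X x W \<in> hom (on_obj (yoneda C X) W) (on_obj F W)"
    using W X x F comm_groupE(1)[OF hom_group[OF W X]]
    by (intro homI)
      (simp_all add: yoneda_map_apply additive_presheaf_closed additive_presheaf_add)
next
  fix V W g y assume "V \<in> Obj C" "W \<in> Obj C" "g \<in> Arr C V W" "y \<in> carrier (on_obj (yoneda C X) W)"
  then show "yoneda_map C F X x V (on_arr (yoneda C X) V W g y)
      = on_arr F V W g (yoneda_map C F X x W y)"
    using F X x by (simp add: yoneda_map_apply comp_closed additive_presheaf_comp)
qed (auto simp: yoneda_map_def)

lemma yoneda_map_at_ident:
  "\<lbrakk>additive_presheaf C F; X \<in> Obj C; x \<in> carrier (on_obj F X)\<rbrakk>
    \<Longrightarrow> yoneda_map C F X x X (Ident C X) = x"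
  by (simp add: yoneda_map_apply ident_closed additive_presheaf_ident)

text \<open>Naturality along \<open>g : W \<rightarrow> X\<close>, applied to the identity of
  \<open>X\<close>, expresses \<open>\<eta> W g\<close> as the action of \<open>g\<close> on
  \<open>\<eta> X (Ident C X)\<close>.\<close>

lemma yoneda_lemma:
  assumes F: "additive_presheaf C F" and X: "X \<in> Obj C" and \<eta>: "\<eta> \<in> nat_trans C (yoneda C X) F"
  shows "\<eta> = yoneda_map C F X (\<eta> X (Ident C X))"
proof (rule nat_trans_eqI[OF \<eta>])
  have x: "\<eta> X (Ident C X) \<in> carrier (on_obj F X)"
    using nat_trans_closed[OF \<eta> X] ident_closed[OF X] by simp
  show "yoneda_map C F X (\<eta> X (Ident C X)) \<in> nat_trans C (yoneda C X) F"
    using F X x by (rule yoneda_map_nat_trans)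
  fix W g assume W: "W \<in> Obj C" and "g \<in> carrier (on_obj (yoneda C X) W)"
  then have g: "g \<in> Arr C W X" by simp
  show "\<eta> W g = yoneda_map C F X (\<eta> X (Ident C X)) W g"
    using nat_trans_natural[OF \<eta> W X g, of "Ident C X"] W X g
    by (simp add: yoneda_map_apply ident_closed comp_ident_left)
qed

text \<open>Naturality of the Yoneda correspondence in the presheaf: it turns composition with
  \<open>\<eta>\<close> into evaluation of \<open>\<eta>\<close> at an element.\<close>

lemma comp_yoneda_map:
  assumes F: "additive_presheaf C F" and G: "additive_presheaf C G" and X: "X \<in> Obj C"
    and x: "x \<in> carrier (on_obj F X)" and \<eta>: "\<eta> \<in> nat_trans C F G"
  shows "Comp (mod_cat C) (yoneda C X) F G \<eta> (yoneda_map C F X x) = yoneda_map C G X (\<eta> X x)"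
proof (rule nat_trans_eqI)
  show "Comp (mod_cat C) (yoneda C X) F G \<eta> (yoneda_map C F X x) \<in> nat_trans C (yoneda C X) G"
    by (rule mod_cat_comp_closed[OF yoneda_additive[OF X] yoneda_map_nat_trans[OF F X x] \<eta>])
  show "yoneda_map C G X (\<eta> X x) \<in> nat_trans C (yoneda C X) G"
    using G X nat_trans_closed[OF \<eta> X x] by (rule yoneda_map_nat_trans)
qed (use X x in \<open>simp add: mod_cat_comp_apply yoneda_map_apply nat_trans_natural[OF \<eta>]\<close>)

text \<open>Naturality of the Yoneda correspondence in the object: precomposition with
  \<open>f\<close> becomes the action of \<open>f\<close> on elements.\<close>

lemma yoneda_map_comp_yoneda_arr:
  assumes F: "additive_presheaf C F" and V: "V \<in> Obj C" and W: "W \<in> Obj C" and f: "f \<in> Arr C V W"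
    and x: "x \<in> carrier (on_obj F W)"
  shows "Comp (mod_cat C) (yoneda C V) (yoneda C W) F (yoneda_map C F W x) (yoneda_arr C V W f)
    = yoneda_map C F V (on_arr F V W f x)"
proof (rule nat_trans_eqI)
  show "Comp (mod_cat C) (yoneda C V) (yoneda C W) F (yoneda_map C F W x) (yoneda_arr C V W f)
      \<in> nat_trans C (yoneda C V) F"
    by (rule mod_cat_comp_closed[OF yoneda_additive[OF V] yoneda_arr_nat_trans[OF V W f]
          yoneda_map_nat_trans[OF F W x]])
  show "yoneda_map C F V (on_arr F V W f x) \<in> nat_trans C (yoneda C V) F"
    using F V additive_presheaf_closed[OF F V W f x] by (rule yoneda_map_nat_trans)
qed (use F V W f x in \<open>simp add: mod_cat_comp_apply yoneda_map_apply yoneda_arr_apply comp_closed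
    additive_presheaf_comp\<close>)

lemma yoneda_map_mult:
  assumes F: "additive_presheaf C F" and X: "X \<in> Obj C"
    and x: "x \<in> carrier (on_obj F X)" and y: "y \<in> carrier (on_obj F X)"
  shows "yoneda_map C F X (x \<otimes>\<^bsub>on_obj F X\<^esub> y)
    = yoneda_map C F X x \<otimes>\<^bsub>Hom (mod_cat C) (yoneda C X) F\<^esub> yoneda_map C F X y"
  unfolding yoneda_map_def mod_cat_def
  using X x y hom_mult[OF additive_presheaf_hom[OF F _ X] x y]
  by (auto simp: fun_eq_iff restrict_def)

lemma yoneda_map_zero:
  assumes F: "additive_presheaf C F" and X: "X \<in> Obj C"
  shows "yoneda_map C F X \<one>\<^bsub>on_obj F X\<^esub> = Zero (mod_cat C) (yoneda C X) F"
  unfolding yoneda_map_def mod_cat_def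
  using hom_one[OF additive_presheaf_hom[OF F _ X]] additive_presheaf_group[OF F] X
    comm_group.axioms(2)
  by (fastforce simp: fun_eq_iff restrict_def)

text \<open>The zero endomorphism of \<open>X\<close> serves as presentation: its image is trivial,
  and so is the kernel of the identity.\<close>

lemma yoneda_fp:
  assumes X: "X \<in> Obj C"
  shows "yoneda C X \<in> fp_functors C"
proof -
  let ?z = "Zero C X X"
  have z: "?z \<in> Arr C X X" using comm_groupE(2)[OF hom_group[OF X X]] .
  have "right_exact C (yoneda C X) (yoneda C X) (yoneda C X) (yoneda_arr C X X ?z)
      (Ident (mod_cat C) (yoneda C X))"
    unfolding right_exact_def
  proof (intro conjI ballI)
    fix W assume W: "W \<in> Obj C"
    have "Zero C W X \<in> Arr C W X" using comm_groupE(2)[OF hom_group[OF W X]] .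
    then show "yoneda_arr C X X ?z W ` carrier (on_obj (yoneda C X) W)
        = kernel (on_obj (yoneda C X) W) (on_obj (yoneda C X) W) (Ident (mod_cat C) (yoneda C X) W)"
      using W X by (auto simp: kernel_def image_iff yoneda_arr_apply comp_zero_left mod_cat_ident_apply)
    show "Ident (mod_cat C) (yoneda C X) W ` carrier (on_obj (yoneda C X) W)
        = carrier (on_obj (yoneda C X) W)"
      using W by (force simp: mod_cat_ident_apply)
  qed (use X z in \<open>auto intro: yoneda_arr_nat_trans mod_cat_ident_closed yoneda_additive\<close>)
  then show ?thesis
    using X z yoneda_additive[OF X] unfolding fp_functors_def presented_by_def by blast
qed

lemma yoneda_representable:
  assumes X: "X \<in> Obj C"
  shows "yoneda C X \<in> representables C"
proof -
  let ?I = "Ident (mod_cat C) (yoneda C X)"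
  have I: "?I \<in> nat_trans C (yoneda C X) (yoneda C X)"
    by (rule mod_cat_ident_closed[OF yoneda_additive[OF X]])
  have "Comp (mod_cat C) (yoneda C X) (yoneda C X) (yoneda C X) ?I ?I = ?I"
    by (rule nat_trans_eqI[OF mod_cat_comp_closed[OF yoneda_additive[OF X] I I] I])
      (simp add: mod_cat_comp_apply mod_cat_ident_apply)
  then have "is_isomorphism (mod_cat C) (yoneda C X) (yoneda C X) ?I"
    using I by (auto simp: is_isomorphism_def)
  then show ?thesis
    using X yoneda_fp[OF X] by (auto simp: representables_def isomorphic_def)
qed


section \<open>Kernels and epimorphisms of finitely presented functors\<close>

text \<open>The universal property is tested on \<open>yoneda C W\<close>, whose maps into a
  presheaf are the elements at \<open>W\<close>. Uniqueness of lifts gives injectivity of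
  \<open>\<kappa> W\<close>. Existence gives a lift \<open>u\<close> for each element killed by
  \<open>\<alpha> W\<close>, and \<open>u\<close> at the identity is a preimage of that
  element.\<close>

lemma kernel_pointwise:
  assumes F: "F \<in> fp_functors C" and G: "G \<in> fp_functors C"
    and ker: "is_kernel (mod_cat C) F G \<alpha> K \<kappa>" and W: "W \<in> Obj C"
  shows "inj_on (\<kappa> W) (carrier (on_obj K W))"
    and "\<kappa> W ` carrier (on_obj K W) = kernel (on_obj F W) (on_obj G W) (\<alpha> W)"
proof -
  note aF = fp_functors_additive[OF F] and aG = fp_functors_additive[OF G]
  have \<alpha>: "\<alpha> \<in> nat_trans C F G" and K: "K \<in> fp_functors C" and \<kappa>: "\<kappa> \<in> nat_trans C K F"
    and zero: "Comp (mod_cat C) K F G \<alpha> \<kappa> = Zero (mod_cat C) K G"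
    using ker by (auto simp: is_kernel_def)
  note aK = fp_functors_additive[OF K]
  have lift: "\<exists>!u. u \<in> nat_trans C (yoneda C W) K \<and>
      Comp (mod_cat C) (yoneda C W) K F \<kappa> u = yoneda_map C F W x"
    if x: "x \<in> carrier (on_obj F W)" "\<alpha> W x = \<one>\<^bsub>on_obj G W\<^esub>" for x
  proof -
    have "Comp (mod_cat C) (yoneda C W) F G \<alpha> (yoneda_map C F W x) = Zero (mod_cat C) (yoneda C W) G"
      using comp_yoneda_map[OF aF aG W x(1) \<alpha>] yoneda_map_zero[OF aG W] x(2) by simp
    then show ?thesis
      using ker yoneda_fp[OF W] yoneda_map_nat_trans[OF aF W x(1)]
      unfolding is_kernel_def Obj_mod_cat Arr_mod_cat by blast
  qed
  have \<kappa>_closed: "\<kappa> W x \<in> carrier (on_obj F W)" if "x \<in> carrier (on_obj K W)" for x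
    using nat_trans_closed[OF \<kappa> W that] .
  have \<alpha>\<kappa>: "\<alpha> W (\<kappa> W x) = \<one>\<^bsub>on_obj G W\<^esub>" if "x \<in> carrier (on_obj K W)" for x
    using mod_cat_comp_apply[OF W that, of F G \<alpha> \<kappa>] zero mod_cat_zero_apply[OF W that, of G] by simp
  show "inj_on (\<kappa> W) (carrier (on_obj K W))"
  proof (rule inj_onI)
    fix x y assume x: "x \<in> carrier (on_obj K W)" and y: "y \<in> carrier (on_obj K W)"
      and eq: "\<kappa> W x = \<kappa> W y"
    have "yoneda_map C K W x = yoneda_map C K W y"
      using lift[OF \<kappa>_closed[OF x] \<alpha>\<kappa>[OF x]]
        yoneda_map_nat_trans[OF aK W x] yoneda_map_nat_trans[OF aK W y]
        comp_yoneda_map[OF aK aF W x \<kappa>] comp_yoneda_map[OF aK aF W y \<kappa>, folded eq]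
      by blast
    then show "x = y"
      using yoneda_map_at_ident[OF aK W x] yoneda_map_at_ident[OF aK W y] by metis
  qed
  show "\<kappa> W ` carrier (on_obj K W) = kernel (on_obj F W) (on_obj G W) (\<alpha> W)"
  proof (intro equalityI subsetI)
    fix x assume "x \<in> \<kappa> W ` carrier (on_obj K W)"
    then show "x \<in> kernel (on_obj F W) (on_obj G W) (\<alpha> W)"
      using \<kappa>_closed \<alpha>\<kappa> by (auto simp: kernel_def)
  next
    fix x assume "x \<in> kernel (on_obj F W) (on_obj G W) (\<alpha> W)"
    then have x: "x \<in> carrier (on_obj F W)" "\<alpha> W x = \<one>\<^bsub>on_obj G W\<^esub>"
      by (auto simp: kernel_def)
    obtain u where u: "u \<in> nat_trans C (yoneda C W) K"
      and eq: "Comp (mod_cat C) (yoneda C W) K F \<kappa> u = yoneda_map C F W x"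
      using lift[OF x] by blast
    have id: "Ident C W \<in> carrier (on_obj (yoneda C W) W)" using ident_closed[OF W] by simp
    have "\<kappa> W (u W (Ident C W)) = x"
      using mod_cat_comp_apply[OF W id, of K F \<kappa> u] eq yoneda_map_at_ident[OF aF W x(1)] by simp
    then show "x \<in> \<kappa> W ` carrier (on_obj K W)"
      using nat_trans_closed[OF u W id] by blast
  qed
qed

lemma epi_if_surjective:
  assumes F: "F \<in> fp_functors C" and \<alpha>: "\<alpha> \<in> nat_trans C F G"
    and surj: "\<And>W. W \<in> Obj C \<Longrightarrow> \<alpha> W ` carrier (on_obj F W) = carrier (on_obj G W)"
  shows "is_epi (mod_cat C) F G \<alpha>"
  unfolding is_epi_def Arr_mod_cat Obj_mod_cat
proof (intro conjI ballI impI)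
  fix T u v assume u: "u \<in> nat_trans C G T" and v: "v \<in> nat_trans C G T"
    and eq: "Comp (mod_cat C) F G T u \<alpha> = Comp (mod_cat C) F G T v \<alpha>"
  show "u = v"
  proof (rule nat_trans_eqI[OF u v])
    fix W y assume W: "W \<in> Obj C" and "y \<in> carrier (on_obj G W)"
    then obtain x where x: "x \<in> carrier (on_obj F W)" "y = \<alpha> W x" using surj[OF W] by blast
    show "u W y = v W y"
      using mod_cat_comp_apply[OF W x(1), of G T _ \<alpha>] eq x(2) by metis
  qed
qed (rule \<alpha>)

text \<open>A map that vanishes after \<open>\<kappa>\<close> vanishes on the kernel of
  \<open>\<gamma>\<close>, so it descends along the surjection \<open>\<gamma>\<close>. The
  descended map is unique because \<open>\<gamma>\<close> is an epimorphism.\<close>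

lemma cokernel_if_exact:
  assumes K: "K \<in> fp_functors C" and Y: "Y \<in> fp_functors C" and Q: "Q \<in> fp_functors C"
    and \<kappa>: "\<kappa> \<in> nat_trans C K Y" and \<gamma>: "\<gamma> \<in> nat_trans C Y Q"
    and surj: "\<And>W. W \<in> Obj C \<Longrightarrow> \<gamma> W ` carrier (on_obj Y W) = carrier (on_obj Q W)"
    and exact: "\<And>W. W \<in> Obj C \<Longrightarrow>
      \<kappa> W ` carrier (on_obj K W) = kernel (on_obj Y W) (on_obj Q W) (\<gamma> W)"
  shows "is_cokernel (mod_cat C) K Y \<kappa> Q \<gamma>"
  unfolding is_cokernel_def Arr_mod_cat Obj_mod_cat
proof (intro conjI ballI impI)
  note aK = fp_functors_additive[OF K] and aY = fp_functors_additive[OF Y]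
    and aQ = fp_functors_additive[OF Q]
  show "Comp (mod_cat C) K Y Q \<gamma> \<kappa> = Zero (mod_cat C) K Q"
  proof (rule nat_trans_eqI[OF mod_cat_comp_closed[OF aK \<kappa> \<gamma>] mod_cat_zero_closed[OF aK aQ]])
    fix W x assume W: "W \<in> Obj C" and x: "x \<in> carrier (on_obj K W)"
    then have "\<kappa> W x \<in> kernel (on_obj Y W) (on_obj Q W) (\<gamma> W)" using exact[OF W] by blast
    then show "Comp (mod_cat C) K Y Q \<gamma> \<kappa> W x = Zero (mod_cat C) K Q W x"
      using W x by (simp add: mod_cat_comp_apply mod_cat_zero_apply kernel_def)
  qed
  fix T t assume T: "T \<in> fp_functors C" and t: "t \<in> nat_trans C Y T"
    and zero: "Comp (mod_cat C) K Y T t \<kappa> = Zero (mod_cat C) K T"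
  have "kernel (on_obj Y W) (on_obj Q W) (\<gamma> W) \<subseteq> kernel (on_obj Y W) (on_obj T W) (t W)"
    if W: "W \<in> Obj C" for W
  proof
    fix y assume y: "y \<in> kernel (on_obj Y W) (on_obj Q W) (\<gamma> W)"
    then obtain x where x: "x \<in> carrier (on_obj K W)" "y = \<kappa> W x"
      using exact[OF W] by blast
    have "t W y = \<one>\<^bsub>on_obj T W\<^esub>"
      using mod_cat_comp_apply[OF W x(1), of Y T t \<kappa>] mod_cat_zero_apply[OF W x(1), of T] zero x(2)
      by simp
    then show "y \<in> kernel (on_obj Y W) (on_obj T W) (t W)"
      using y by (simp add: kernel_def)
  qed
  then obtain u where u: "u \<in> nat_trans C Q T"
    and u_eq: "\<And>W y. \<lbrakk>W \<in> Obj C; y \<in> carrier (on_obj Y W)\<rbrakk> \<Longrightarrow> u W (\<gamma> W y) = t W y"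
    using nat_trans_factor[OF aY aQ fp_functors_additive[OF T] \<gamma> t surj] by metis
  show "\<exists>!u. u \<in> nat_trans C Q T \<and> Comp (mod_cat C) Y Q T u \<gamma> = t"
  proof (rule ex1I)
    show ut: "u \<in> nat_trans C Q T \<and> Comp (mod_cat C) Y Q T u \<gamma> = t"
      using u nat_trans_eqI[OF mod_cat_comp_closed[OF aY \<gamma> u] t] u_eq
      by (simp add: mod_cat_comp_apply)
    fix v assume "v \<in> nat_trans C Q T \<and> Comp (mod_cat C) Y Q T v \<gamma> = t"
    then show "v = u"
      using ut epi_if_surjective[OF Y \<gamma> surj] T by (auto simp: is_epi_def)
  qed
qed (use \<kappa> \<gamma> Q in auto)

end

section \<open>Pointwise cokernels are finitely presented, and epimorphisms are pointwise
  surjective\<close>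

context additive_category
begin

text \<open>If \<open>a : A \<rightarrow> B\<close> presents \<open>Y\<close>, \<open>Hom(-, D)\<close> covers \<open>K\<close> and \<open>h : D \<rightarrow> B\<close> lifts \<open>Hom(-, D) \<rightarrow> K \<rightarrow> Y\<close>,
  then \<open>(a, h) : A \<oplus> D \<rightarrow> B\<close> presents \<open>Q\<close>.\<close>

lemma fp_functors_cokernel:
  fixes K Y Q :: "('a, 'b, 'b) presheaf"
  assumes K: "K \<in> fp_functors C" and Y: "Y \<in> fp_functors C" and Q: "additive_presheaf C Q"
    and \<kappa>: "\<kappa> \<in> nat_trans C K Y" and \<gamma>: "\<gamma> \<in> nat_trans C Y Q"
    and surj: "\<And>W. W \<in> Obj C \<Longrightarrow> \<gamma> W ` carrier (on_obj Y W) = carrier (on_obj Q W)"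
    and exact: "\<And>W. W \<in> Obj C \<Longrightarrow>
      \<kappa> W ` carrier (on_obj K W) = kernel (on_obj Y W) (on_obj Q W) (\<gamma> W)"
  shows "Q \<in> fp_functors C"
proof -
  note aK = fp_functors_additive[OF K] and aY = fp_functors_additive[OF Y]
  obtain A B a \<pi> where A: "A \<in> Obj C" and B: "B \<in> Obj C" and a: "a \<in> Arr C A B"
    and \<pi>: "right_exact C (yoneda C A) (yoneda C B) Y (yoneda_arr C A B a) \<pi>"
    using Y unfolding fp_functors_def presented_by_def by blast
  obtain D \<rho> where D: "D \<in> Obj C" and \<rho>: "\<rho> \<in> nat_trans C (yoneda C D) K"
    and \<rho>_surj: "\<And>W. W \<in> Obj C \<Longrightarrow> \<rho> W ` Arr C W D = carrier (on_obj K W)"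
    using K unfolding fp_functors_def presented_by_def right_exact_def by fastforce
  have \<pi>_nat: "\<pi> \<in> nat_trans C (yoneda C B) Y"
    and \<pi>_surj: "\<And>W. W \<in> Obj C \<Longrightarrow> \<pi> W ` Arr C W B = carrier (on_obj Y W)"
    and \<pi>_exact: "\<And>W b. \<lbrakk>W \<in> Obj C; b \<in> Arr C W B\<rbrakk> \<Longrightarrow>
      \<pi> W b = \<one>\<^bsub>on_obj Y W\<^esub> \<longleftrightarrow> (\<exists>e\<in>Arr C W A. b = Comp C W A B a e)"
    subgoal using \<pi> by (simp add: right_exact_def)
    subgoal using \<pi> by (simp add: right_exact_def)
    subgoal for W b
    proof -
      assume W: "W \<in> Obj C" and b: "b \<in> Arr C W B"
      have "yoneda_arr C A B a W ` Arr C W A = kernel (Hom C W B) (on_obj Y W) (\<pi> W)"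
        using \<pi> W by (simp add: right_exact_def)
      moreover have "b \<in> kernel (Hom C W B) (on_obj Y W) (\<pi> W) \<longleftrightarrow> \<pi> W b = \<one>\<^bsub>on_obj Y W\<^esub>"
        using b by (simp add: kernel_def)
      moreover have "yoneda_arr C A B a W ` Arr C W A = (\<lambda>e. Comp C W A B a e) ` Arr C W A"
        using W by (intro image_cong) (simp_all add: yoneda_arr_apply)
      ultimately show ?thesis by auto
    qed
    done
  have idD: "Ident C D \<in> carrier (on_obj (yoneda C D) D)" using ident_closed[OF D] by simp
  \<comment> \<open>By Yoneda, the composite of \<open>\<rho>\<close> and \<open>\<kappa>\<close> is
    determined by its value at the identity of \<open>D\<close>; \<open>h\<close> is a preimage of
    that value under \<open>\<pi> D\<close>. Naturality extends the agreement to all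
    \<open>d\<close> in the fact named \<open>\<pi>h\<close>.\<close>
  obtain h where h: "h \<in> Arr C D B" and h_eq: "\<pi> D h = \<kappa> D (\<rho> D (Ident C D))"
    using \<pi>_surj[OF D] nat_trans_closed[OF \<kappa> D nat_trans_closed[OF \<rho> D idD]]
    by (metis imageE)
  have \<pi>h: "\<pi> W (Comp C W D B h d) = \<kappa> W (\<rho> W d)" if W: "W \<in> Obj C" and d: "d \<in> Arr C W D" for W d
  proof -
    have "\<pi> W (Comp C W D B h d) = on_arr Y W D d (\<kappa> D (\<rho> D (Ident C D)))"
      using nat_trans_natural[OF \<pi>_nat W D d, of h] h h_eq by simp
    also have "\<dots> = \<kappa> W (on_arr K W D d (\<rho> D (Ident C D)))"
      using nat_trans_natural[OF \<kappa> W D d nat_trans_closed[OF \<rho> D idD]] by simp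
    also have "\<dots> = \<kappa> W (\<rho> W d)"
      using nat_trans_natural[OF \<rho> W D d idD] W D d by (simp add: comp_ident_left)
    finally show ?thesis .
  qed
  obtain S i j p q where "is_biproduct C A D S i j p q" using biproducts[OF A D] by blast
  then have S: "S \<in> Obj C" and i: "i \<in> Arr C A S" and j: "j \<in> Arr C D S"
    and p: "p \<in> Arr C S A" and q: "q \<in> Arr C S D"
    and pi: "Comp C A S A p i = Ident C A" and qj: "Comp C D S D q j = Ident C D"
    and pj: "Comp C D S A p j = Zero C D A" and qi: "Comp C A S D q i = Zero C A D"
    by (auto simp: is_biproduct_def)
  \<comment> \<open>The row \<open>(a, h)\<close> written through the projections of the biproduct
    \<open>S\<close> of \<open>A\<close> and \<open>D\<close>.\<close>
  define s where "s = Comp C S A B a p \<otimes>\<^bsub>Hom C S B\<^esub> Comp C S D B h q"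
  have s: "s \<in> Arr C S B"
    unfolding s_def using comm_groupE(1)[OF hom_group[OF S B]] A B D S a p h q
    by (simp add: comp_closed)
  have s_comp: "Comp C W S B s g
      = Comp C W A B a (Comp C W S A p g) \<otimes>\<^bsub>Hom C W B\<^esub> Comp C W D B h (Comp C W S D q g)"
    if "W \<in> Obj C" "g \<in> Arr C W S" for W g
    unfolding s_def using that A B D S a p h q by (simp add: comp_add_left comp_closed comp_assoc)
  define \<omega> where "\<omega> = Comp (mod_cat C) (yoneda C B) Y Q \<gamma> \<pi>"
  have \<omega>: "\<omega> \<in> nat_trans C (yoneda C B) Q"
    unfolding \<omega>_def by (rule mod_cat_comp_closed[OF yoneda_additive[OF B] \<pi>_nat \<gamma>])
  have \<omega>_apply: "\<omega> W b = \<gamma> W (\<pi> W b)" if "W \<in> Obj C" "b \<in> Arr C W B" for W b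
    unfolding \<omega>_def using that by (simp add: mod_cat_comp_apply)
  have "yoneda_arr C S B s W ` Arr C W S = kernel (Hom C W B) (on_obj Q W) (\<omega> W)"
    if W: "W \<in> Obj C" for W
  proof (intro equalityI subsetI)
    interpret Y: comm_group "on_obj Y W" using additive_presheaf_group[OF aY W] .
    interpret Q: comm_group "on_obj Q W" using additive_presheaf_group[OF Q W] .
    interpret H: comm_group "Hom C W B" using hom_group[OF W B] .
    have \<gamma>\<kappa>: "\<gamma> W (\<kappa> W k) = \<one>\<^bsub>on_obj Q W\<^esub>" if "k \<in> carrier (on_obj K W)" for k
      using exact[OF W] that by (auto simp: kernel_def)
    {
      fix b assume "b \<in> yoneda_arr C S B s W ` Arr C W S"
      then obtain g where g: "g \<in> Arr C W S" and b: "b = Comp C W S B s g"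
        using W by (auto simp: yoneda_arr_apply)
      let ?e = "Comp C W S A p g" and ?d = "Comp C W S D q g"
      have e: "?e \<in> Arr C W A" and d: "?d \<in> Arr C W D"
        using g W A D S p q by (simp_all add: comp_closed)
      have ae: "Comp C W A B a ?e \<in> Arr C W B" and hd: "Comp C W D B h ?d \<in> Arr C W B"
        using e d W A B D a h by (simp_all add: comp_closed)
      have \<kappa>d: "\<kappa> W (\<rho> W ?d) \<in> carrier (on_obj Y W)"
        using nat_trans_closed[OF \<kappa> W nat_trans_closed[OF \<rho> W]] d by simp
      have bB: "b \<in> Arr C W B" using b g s W S B by (simp add: comp_closed)
      \<comment> \<open>The summand through \<open>a\<close> is killed by \<open>\<pi>\<close>, and
        the summand through \<open>h\<close> is sent into the image of \<open>\<kappa>\<close>,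
        which \<open>\<gamma>\<close> kills in turn.\<close>
      have "\<pi> W b = \<kappa> W (\<rho> W ?d)"
        using nat_trans_mult[OF \<pi>_nat W, of "Comp C W A B a ?e" "Comp C W D B h ?d"] ae hd b
          s_comp[OF W g] \<pi>_exact[OF W ae] e \<pi>h[OF W d] \<kappa>d by auto
      then have "\<omega> W b = \<one>\<^bsub>on_obj Q W\<^esub>"
        using \<omega>_apply[OF W bB] \<gamma>\<kappa> nat_trans_closed[OF \<rho> W] d by simp
      then show "b \<in> kernel (Hom C W B) (on_obj Q W) (\<omega> W)" using bB by (simp add: kernel_def)
    next
      \<comment> \<open>Here \<open>\<pi> W b\<close> comes from \<open>K\<close>, so it equals the
        image under \<open>\<pi>\<close> of \<open>h\<close> composed with some \<open>d\<close>.
        The difference of \<open>b\<close> and that composite is killed by \<open>\<pi>\<close>,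
        hence factors through \<open>a\<close> by some \<open>e\<close>.\<close>
      fix b assume "b \<in> kernel (Hom C W B) (on_obj Q W) (\<omega> W)"
      then have b: "b \<in> Arr C W B" and "\<gamma> W (\<pi> W b) = \<one>\<^bsub>on_obj Q W\<^esub>"
        using \<omega>_apply[OF W] by (auto simp: kernel_def)
      then have "\<pi> W b \<in> kernel (on_obj Y W) (on_obj Q W) (\<gamma> W)"
        using nat_trans_closed[OF \<pi>_nat W] by (simp add: kernel_def)
      then obtain k where k: "k \<in> carrier (on_obj K W)" "\<pi> W b = \<kappa> W k"
        using exact[OF W] by blast
      then obtain d where d: "d \<in> Arr C W D" "k = \<rho> W d" using \<rho>_surj[OF W] by blast
      let ?hd = "Comp C W D B h d"
      have hd: "?hd \<in> Arr C W B" using d W D B h by (simp add: comp_closed)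
      have "b \<otimes>\<^bsub>Hom C W B\<^esub> inv\<^bsub>Hom C W B\<^esub> ?hd \<in> kernel (Hom C W B) (on_obj Y W) (\<pi> W)"
        using nat_trans_eq_iff_kernel[OF \<pi>_nat yoneda_additive[OF B] aY W, of b ?hd] b hd
          \<pi>h[OF W d(1)] k d(2) by simp
      then obtain e where e: "e \<in> Arr C W A"
        and b_eq: "b \<otimes>\<^bsub>Hom C W B\<^esub> inv\<^bsub>Hom C W B\<^esub> ?hd = Comp C W A B a e"
        using \<pi>_exact[OF W] b hd by (auto simp: kernel_def)
      have ie: "Comp C W A S i e \<in> Arr C W S" and jd: "Comp C W D S j d \<in> Arr C W S"
        using e d i j W A D S by (simp_all add: comp_closed)
      \<comment> \<open>The map into the biproduct with components \<open>e\<close> and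
        \<open>d\<close>; composing it with \<open>s\<close> adds up the two parts of
        \<open>b\<close>.\<close>
      define g where "g = Comp C W A S i e \<otimes>\<^bsub>Hom C W S\<^esub> Comp C W D S j d"
      have g: "g \<in> Arr C W S"
        unfolding g_def using comm_groupE(1)[OF hom_group[OF W S] ie jd] .
      have "Comp C W S A p g = e"
        unfolding g_def using W A D S p ie jd e d i j comm_groupE(2,3,5) hom_group[OF W A]
        by (simp add: comp_add_right comp_assoc[symmetric] pi pj comp_ident_left comp_zero_left
            monoid.r_one comm_group.axioms(2) group.is_monoid)
      moreover have "Comp C W S D q g = d"
        unfolding g_def using W A D S q ie jd e d i j hom_group[OF W D]
        by (simp add: comp_add_right comp_assoc[symmetric] qi qj comp_ident_left comp_zero_left
            comm_groupE(5))
      moreover have "b = Comp C W A B a e \<otimes>\<^bsub>Hom C W B\<^esub> ?hd"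
        unfolding b_eq[symmetric] using b hd by (simp add: H.m_assoc)
      ultimately have "Comp C W S B s g = b"
        using s_comp[OF W g] by simp
      then show "b \<in> yoneda_arr C S B s W ` Arr C W S"
        using g W by (auto simp: yoneda_arr_apply image_iff)
    }
  qed
  moreover have "\<omega> W ` Arr C W B = carrier (on_obj Q W)" if W: "W \<in> Obj C" for W
  proof -
    have "\<omega> W ` Arr C W B = \<gamma> W ` \<pi> W ` Arr C W B"
      unfolding image_image using \<omega>_apply[OF W] by (intro image_cong) simp_all
    then show ?thesis using \<pi>_surj[OF W] surj[OF W] by simp
  qed
  ultimately have "right_exact C (yoneda C S) (yoneda C B) Q (yoneda_arr C S B s) \<omega>"
    using \<omega> yoneda_arr_nat_trans[OF S B s] by (simp add: right_exact_def)
  then show ?thesis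
    using Q S B s unfolding fp_functors_def presented_by_def by blast
qed


text \<open>The pointwise image of \<open>\<gamma>\<close> is again finitely presented, so its inclusion \<open>\<iota>\<close> into \<open>Q\<close> is a
  monomorphism of \<open>mod(C)\<close>, hence a kernel of some \<open>g\<close>. As \<open>g\<close> vanishes on the image of the
  epimorphism \<open>\<gamma>\<close>, it is zero.\<close>

lemma epi_surjective:
  fixes Y Q :: "('a, 'b, 'b) presheaf"
  assumes ab: "abelian_category (mod_cat C)"
    and Y: "Y \<in> fp_functors C" and Q: "Q \<in> fp_functors C"
    and epi: "is_epi (mod_cat C) Y Q \<gamma>" and W: "W \<in> Obj C"
  shows "\<gamma> W ` carrier (on_obj Y W) = carrier (on_obj Q W)"
proof -
  interpret M: abelian_category "mod_cat C" by (rule ab)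
  note aY = fp_functors_additive[OF Y] and aQ = fp_functors_additive[OF Q]
  have \<gamma>: "\<gamma> \<in> nat_trans C Y Q" using epi by (simp add: is_epi_def)
  obtain K \<kappa> where ker: "is_kernel (mod_cat C) Y Q \<gamma> K \<kappa>" using M.kernels[of Y Q \<gamma>] Y Q \<gamma> by auto
  then have K: "K \<in> fp_functors C" and \<kappa>: "\<kappa> \<in> nat_trans C K Y" by (auto simp: is_kernel_def)
  \<comment> \<open>The image presheaf: only the carriers shrink, while the group operations and the
    action of arrows remain those of \<open>Q\<close>.\<close>
  define I where "I = Q\<lparr>on_obj := \<lambda>V. (on_obj Q V)\<lparr>carrier := \<gamma> V ` carrier (on_obj Y V)\<rparr>\<rparr>"
  have carrier_I: "carrier (on_obj I V) = \<gamma> V ` carrier (on_obj Y V)"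
    and mult_I: "mult (on_obj I V) = mult (on_obj Q V)" and one_I: "one (on_obj I V) = one (on_obj Q V)"
    and arr_I: "on_arr I = on_arr Q" for V
    by (simp_all add: I_def)
  have sub: "\<gamma> V ` carrier (on_obj Y V) \<subseteq> carrier (on_obj Q V)" if "V \<in> Obj C" for V
    using nat_trans_closed[OF \<gamma> that] by blast
  have I_arr_closed: "on_arr Q V V' f z \<in> \<gamma> V ` carrier (on_obj Y V)"
    if "V \<in> Obj C" "V' \<in> Obj C" "f \<in> Arr C V V'" "z \<in> \<gamma> V' ` carrier (on_obj Y V')" for V V' f z
    using that(4) nat_trans_natural[OF \<gamma> that(1-3), symmetric] additive_presheaf_closed[OF aY that(1-3)]
    by auto
  have aI: "additive_presheaf C I"
    unfolding additive_presheaf_def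
  proof (intro conjI ballI)
    fix V assume V: "V \<in> Obj C"
    interpret Y: comm_group "on_obj Y V" using aY V by (rule additive_presheaf_group)
    interpret Q: comm_group "on_obj Q V" using aQ V by (rule additive_presheaf_group)
    interpret group_hom "on_obj Y V" "on_obj Q V" "\<gamma> V"
      by unfold_locales (rule nat_trans_hom[OF \<gamma> V])
    have "group (on_obj I V)"
      using subgroup.subgroup_is_group[OF img_is_subgroup Q.is_group] by (simp add: I_def)
    then show "comm_group (on_obj I V)"
      using sub[OF V] by (auto intro!: group.group_comm_groupI Q.m_comm simp: carrier_I mult_I)
  next
    fix V V' f assume "V \<in> Obj C" "V' \<in> Obj C" "f \<in> Arr C V V'"
    then show "on_arr I V V' f \<in> hom (on_obj I V') (on_obj I V)"
      using hom_mult[OF additive_presheaf_hom[OF aQ]] sub I_arr_closed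
      by (intro homI) (auto simp: carrier_I mult_I arr_I subset_iff)
  qed (use sub additive_presheaf_ident[OF aQ] additive_presheaf_comp[OF aQ]
      additive_presheaf_add[OF aQ] in \<open>auto simp: carrier_I mult_I arr_I subset_iff\<close>)
  have \<gamma>_I: "\<gamma> \<in> nat_trans C Y I"
    using \<gamma> unfolding nat_trans_def by (auto simp: hom_def carrier_I mult_I arr_I)
  have kernel_I: "kernel (on_obj Y V) (on_obj I V) (\<gamma> V) = kernel (on_obj Y V) (on_obj Q V) (\<gamma> V)" for V
    by (simp add: kernel_def one_I)
  \<comment> \<open>As \<open>\<gamma>\<close> is onto \<open>I\<close> with unchanged kernel, and
    \<open>\<kappa>\<close> maps onto that kernel, \<open>I\<close> is a pointwise cokernel of
    \<open>\<kappa>\<close>.\<close>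
  have I: "I \<in> fp_functors C"
    by (rule fp_functors_cokernel[OF K Y aI \<kappa> \<gamma>_I])
      (simp_all add: carrier_I kernel_I kernel_pointwise[OF Y Q ker])
  define \<iota> where "\<iota> = (\<lambda>V\<in>Obj C. \<lambda>z\<in>carrier (on_obj I V). z)"
  have \<iota>_apply: "\<iota> V z = z" if "V \<in> Obj C" "z \<in> carrier (on_obj I V)" for V z
    using that by (simp add: \<iota>_def)
  have \<iota>: "\<iota> \<in> nat_trans C I Q"
  proof (rule nat_transI)
    fix V assume V: "V \<in> Obj C"
    show "\<iota> V \<in> hom (on_obj I V) (on_obj Q V)"
      using V sub[OF V] \<iota>_apply[OF V] comm_groupE(1)[OF additive_presheaf_group[OF aI V]]
      by (intro homI) (auto simp: carrier_I mult_I)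
  qed (use I_arr_closed in \<open>auto simp: \<iota>_def carrier_I arr_I\<close>)
  have "is_mono (mod_cat C) I Q \<iota>"
    unfolding is_mono_def Arr_mod_cat Obj_mod_cat
  proof (intro conjI ballI impI)
    fix T u v assume u: "u \<in> nat_trans C T I" and v: "v \<in> nat_trans C T I"
      and eq: "Comp (mod_cat C) T I Q \<iota> u = Comp (mod_cat C) T I Q \<iota> v"
    show "u = v"
    proof (rule nat_trans_eqI[OF u v])
      fix V t assume V: "V \<in> Obj C" and t: "t \<in> carrier (on_obj T V)"
      show "u V t = v V t"
        using mod_cat_comp_apply[OF V t, of I Q \<iota>] eq \<iota>_apply[OF V]
          nat_trans_closed[OF u V t] nat_trans_closed[OF v V t] by metis
    qed
  qed (rule \<iota>)
  then obtain Z g where Z: "Z \<in> fp_functors C" and g_ker: "is_kernel (mod_cat C) Q Z g I \<iota>"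
    using M.mono_is_kernel[of I Q \<iota>] I Q by auto
  then have g: "g \<in> nat_trans C Q Z" by (simp add: is_kernel_def)
  note aZ = fp_functors_additive[OF Z]
  \<comment> \<open>Kernels are pointwise, so the image of the inclusion \<open>\<iota>\<close>,
    that is the image of \<open>\<gamma>\<close>, is the kernel of \<open>g\<close> at every
    object.\<close>
  have ker_g: "\<gamma> V ` carrier (on_obj Y V) = kernel (on_obj Q V) (on_obj Z V) (g V)"
    if "V \<in> Obj C" for V
    using kernel_pointwise(2)[OF Q Z g_ker that] \<iota>_apply[OF that] by (simp add: carrier_I)
  let ?z = "Zero (mod_cat C) Q Z"
  have "Comp (mod_cat C) Y Q Z g \<gamma> = Comp (mod_cat C) Y Q Z ?z \<gamma>"
  proof (rule nat_trans_eqI[OF mod_cat_comp_closed[OF aY \<gamma> g]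
        mod_cat_comp_closed[OF aY \<gamma> mod_cat_zero_closed[OF aQ aZ]]])
    fix V y assume V: "V \<in> Obj C" and y: "y \<in> carrier (on_obj Y V)"
    then have "\<gamma> V y \<in> kernel (on_obj Q V) (on_obj Z V) (g V)" using ker_g by blast
    then show "Comp (mod_cat C) Y Q Z g \<gamma> V y = Comp (mod_cat C) Y Q Z ?z \<gamma> V y"
      using V y by (simp add: mod_cat_comp_apply mod_cat_zero_apply kernel_def)
  qed
  then have "g = ?z"
    using epi Z g mod_cat_zero_closed[OF aQ aZ] by (simp add: is_epi_def)
  then have "kernel (on_obj Q W) (on_obj Z W) (g W) = carrier (on_obj Q W)"
    using mod_cat_zero_apply[OF W, of _ Q Z] by (auto simp: kernel_def)
  then show ?thesis using ker_g[OF W] by simp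
qed

end

text \<open>If \<open>u\<close> and \<open>v\<close> agree after \<open>c\<close>, both factor one
  map that vanishes on \<open>f\<close>, so the uniqueness clause identifies them.\<close>

lemma (in preadditive_category) cokernel_is_epi:
  assumes X: "X \<in> Obj C" and Y: "Y \<in> Obj C" and coker: "is_cokernel C X Y f Q c"
  shows "is_epi C Y Q c"
proof -
  have f: "f \<in> Arr C X Y" and Q: "Q \<in> Obj C" and c: "c \<in> Arr C Y Q"
    and zero: "Comp C X Y Q c f = Zero C X Q"
    using coker by (simp_all add: is_cokernel_def)
  show ?thesis
    unfolding is_epi_def
  proof (intro conjI ballI impI)
    fix T u v assume T: "T \<in> Obj C" and u: "u \<in> Arr C Q T" and v: "v \<in> Arr C Q T"
      and eq: "Comp C Y Q T u c = Comp C Y Q T v c"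
    have "Comp C X Y T (Comp C Y Q T u c) f = Zero C X T"
      using X Y Q T f c u zero by (simp add: comp_assoc comp_zero_right)
    then have "\<exists>!w. w \<in> Arr C Q T \<and> Comp C Y Q T w c = Comp C Y Q T u c"
      using coker T comp_closed[OF Y Q T c u] by (simp add: is_cokernel_def)
    then show "u = v" using u v eq by metis
  qed (rule c)
qed

section \<open>Restriction along the Yoneda embedding\<close>

lemma full_subcat_simps [simp]:
  "Obj (full_subcat C S) = S" "Hom (full_subcat C S) = Hom C"
  "Ident (full_subcat C S) = Ident C" "Comp (full_subcat C S) = Comp C"
  by (simp_all add: full_subcat_def)

lemma restrict_yoneda_simps [simp]:
  "on_obj (restrict_yoneda C F) W = on_obj F (yoneda C W)"
  "on_arr (restrict_yoneda C F) V W f = on_arr F (yoneda C V) (yoneda C W) (yoneda_arr C V W f)"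
  by (simp_all add: restrict_yoneda_def)

lemma yoneda_arr_eq_yoneda_map: "yoneda_arr C X Y f = yoneda_map C (yoneda C Y) X f"
  by (simp add: yoneda_arr_def yoneda_map_def)

context preadditive_category
begin

text \<open>The Yoneda embedding preserves identities, composition and sums; these are the three
  local facts \<open>id\<close>, \<open>comp\<close> and \<open>add\<close>.\<close>

lemma restrict_yoneda_additive:
  assumes S: "\<And>W. W \<in> Obj C \<Longrightarrow> yoneda C W \<in> S"
    and F: "additive_presheaf (full_subcat (mod_cat C) S) F"
  shows "additive_presheaf C (restrict_yoneda C F)"
proof -
  have id: "yoneda_arr C X X (Ident C X) = Ident (mod_cat C) (yoneda C X)" if X: "X \<in> Obj C" for X
    by (rule nat_trans_eqI[OF yoneda_arr_nat_trans[OF X X ident_closed[OF X]]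
          mod_cat_ident_closed[OF yoneda_additive[OF X]]])
      (use X in \<open>simp add: yoneda_arr_apply mod_cat_ident_apply comp_ident_left\<close>)
  have comp: "yoneda_arr C X Z (Comp C X Y Z g f) =
      Comp (mod_cat C) (yoneda C X) (yoneda C Y) (yoneda C Z) (yoneda_arr C Y Z g) (yoneda_arr C X Y f)"
    if "X \<in> Obj C" "Y \<in> Obj C" "Z \<in> Obj C" "f \<in> Arr C X Y" "g \<in> Arr C Y Z" for X Y Z f g
    using comp_yoneda_map[of "yoneda C Y" "yoneda C Z" X f "yoneda_arr C Y Z g"] that
    by (simp add: yoneda_additive yoneda_arr_nat_trans yoneda_arr_apply
        flip: yoneda_arr_eq_yoneda_map)
  have add: "yoneda_arr C X Y (f \<otimes>\<^bsub>Hom C X Y\<^esub> g) =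
      yoneda_arr C X Y f \<otimes>\<^bsub>Hom (mod_cat C) (yoneda C X) (yoneda C Y)\<^esub> yoneda_arr C X Y g"
    if "X \<in> Obj C" "Y \<in> Obj C" "f \<in> Arr C X Y" "g \<in> Arr C X Y" for X Y f g
    using yoneda_map_mult[of "yoneda C Y" X f g] that
    by (simp add: yoneda_additive yoneda_arr_eq_yoneda_map)
  show ?thesis
    unfolding additive_presheaf_def restrict_yoneda_simps
  proof (intro conjI ballI)
    fix X assume "X \<in> Obj C"
    then show "comm_group (on_obj F (yoneda C X))"
      using additive_presheaf_group[OF F, of "yoneda C X"] S by simp
  next
    fix X Y f assume "X \<in> Obj C" "Y \<in> Obj C" "f \<in> Arr C X Y"
    then show "on_arr F (yoneda C X) (yoneda C Y) (yoneda_arr C X Y f)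
        \<in> hom (on_obj F (yoneda C Y)) (on_obj F (yoneda C X))"
      using additive_presheaf_hom[OF F, of "yoneda C X" "yoneda C Y"] S yoneda_arr_nat_trans by simp
  next
    fix X x assume "X \<in> Obj C" "x \<in> carrier (on_obj F (yoneda C X))"
    then show "on_arr F (yoneda C X) (yoneda C X) (yoneda_arr C X X (Ident C X)) x = x"
      using additive_presheaf_ident[OF F, of "yoneda C X" x] S id by simp
  next
    fix X Y Z f g z
    assume "X \<in> Obj C" "Y \<in> Obj C" "Z \<in> Obj C" "f \<in> Arr C X Y" "g \<in> Arr C Y Z"
      "z \<in> carrier (on_obj F (yoneda C Z))"
    then show "on_arr F (yoneda C X) (yoneda C Z) (yoneda_arr C X Z (Comp C X Y Z g f)) z
        = on_arr F (yoneda C X) (yoneda C Y) (yoneda_arr C X Y f)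
            (on_arr F (yoneda C Y) (yoneda C Z) (yoneda_arr C Y Z g) z)"
      using additive_presheaf_comp[OF F, of "yoneda C X" "yoneda C Y" "yoneda C Z"
          "yoneda_arr C X Y f" "yoneda_arr C Y Z g" z] S comp yoneda_arr_nat_trans by simp
  next
    fix X Y f g y
    assume "X \<in> Obj C" "Y \<in> Obj C" "f \<in> Arr C X Y" "g \<in> Arr C X Y"
      "y \<in> carrier (on_obj F (yoneda C Y))"
    then show "on_arr F (yoneda C X) (yoneda C Y) (yoneda_arr C X Y (f \<otimes>\<^bsub>Hom C X Y\<^esub> g)) y
        = on_arr F (yoneda C X) (yoneda C Y) (yoneda_arr C X Y f) y
            \<otimes>\<^bsub>on_obj F (yoneda C X)\<^esub> on_arr F (yoneda C X) (yoneda C Y) (yoneda_arr C X Y g) y"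
      using additive_presheaf_add[OF F, of "yoneda C X" "yoneda C Y"
          "yoneda_arr C X Y f" "yoneda_arr C X Y g" y] S add yoneda_arr_nat_trans by simp
  qed
qed

text \<open>The cokernel property is expressed by pointwise exactness because the values of
  \<open>F\<close> lie in an arbitrary type, so the restriction need not be an object of
  \<open>mod_cat C\<close>.\<close>

lemma restrict_yoneda_cokernel:
  fixes F :: "(('o, 'a, 'a) presheaf, 'o \<Rightarrow> 'a \<Rightarrow> 'a, 'v) presheaf"
  assumes S: "S \<subseteq> fp_functors C" "\<And>W. W \<in> Obj C \<Longrightarrow> yoneda C W \<in> S"
    and X: "X \<in> S" and Y: "Y \<in> S" and f: "f \<in> nat_trans C X Y"
    and pres: "presented_by (full_subcat (mod_cat C) S) X Y f F"
  obtains \<sigma> where "\<sigma> \<in> nat_trans C Y (restrict_yoneda C F)"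
    and "\<And>W. W \<in> Obj C \<Longrightarrow> \<sigma> W ` carrier (on_obj Y W) = carrier (on_obj (restrict_yoneda C F) W)"
    and "\<And>W. W \<in> Obj C \<Longrightarrow> f W ` carrier (on_obj X W)
      = kernel (on_obj Y W) (on_obj (restrict_yoneda C F) W) (\<sigma> W)"
proof -
  let ?S = "full_subcat (mod_cat C) S"
  have aX: "additive_presheaf C X" and aY: "additive_presheaf C Y"
    using S(1) X Y fp_functors_additive by blast+
  obtain \<pi> where \<pi>: "\<pi> \<in> nat_trans ?S (yoneda ?S Y) F"
    and exact: "\<And>T. T \<in> S \<Longrightarrow> yoneda_arr ?S X Y f T ` nat_trans C T X
      = kernel (Hom (mod_cat C) T Y) (on_obj F T) (\<pi> T)"
    and surj: "\<And>T. T \<in> S \<Longrightarrow> \<pi> T ` nat_trans C T Y = carrier (on_obj F T)"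
    using pres unfolding presented_by_def right_exact_def by auto
  \<comment> \<open>The presentation map \<open>\<pi>\<close> at \<open>yoneda C W\<close>, read on
    elements of \<open>Y\<close> through the Yoneda correspondence.\<close>
  define \<sigma> where
    "\<sigma> = (\<lambda>W\<in>Obj C. \<lambda>y\<in>carrier (on_obj Y W). \<pi> (yoneda C W) (yoneda_map C Y W y))"
  have \<sigma>_apply: "\<sigma> W y = \<pi> (yoneda C W) (yoneda_map C Y W y)"
    if "W \<in> Obj C" "y \<in> carrier (on_obj Y W)" for W y
    using that by (simp add: \<sigma>_def)
  have \<sigma>: "\<sigma> \<in> nat_trans C Y (restrict_yoneda C F)"
  proof (rule nat_transI)
    fix W assume W: "W \<in> Obj C"
    show "\<sigma> W \<in> hom (on_obj Y W) (on_obj (restrict_yoneda C F) W)"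
    proof (rule homI)
      fix y assume y: "y \<in> carrier (on_obj Y W)"
      then show "\<sigma> W y \<in> carrier (on_obj (restrict_yoneda C F) W)"
        using nat_trans_closed[OF \<pi>, of "yoneda C W" "yoneda_map C Y W y"] W S(2)[OF W] \<sigma>_apply
          yoneda_map_nat_trans[OF aY W] by simp
      fix y' assume y': "y' \<in> carrier (on_obj Y W)"
      show "\<sigma> W (y \<otimes>\<^bsub>on_obj Y W\<^esub> y')
          = \<sigma> W y \<otimes>\<^bsub>on_obj (restrict_yoneda C F) W\<^esub> \<sigma> W y'"
        using nat_trans_mult[OF \<pi>, of "yoneda C W" "yoneda_map C Y W y" "yoneda_map C Y W y'"]
          W S(2)[OF W] \<sigma>_apply[OF W] yoneda_map_nat_trans[OF aY W] yoneda_map_mult[OF aY W y y'] y y'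
          comm_groupE(1)[OF additive_presheaf_group[OF aY W] y y'] by simp
    qed
  next
    fix V W g y assume A: "V \<in> Obj C" "W \<in> Obj C" "g \<in> Arr C V W" and y: "y \<in> carrier (on_obj Y W)"
    \<comment> \<open>This is naturality of \<open>\<pi>\<close> along the Yoneda image of
      \<open>g\<close>, with precomposition rewritten as the action of \<open>g\<close> on
      \<open>y\<close>.\<close>
    show "\<sigma> V (on_arr Y V W g y) = on_arr (restrict_yoneda C F) V W g (\<sigma> W y)"
      using nat_trans_natural[OF \<pi>, of "yoneda C V" "yoneda C W" "yoneda_arr C V W g"
          "yoneda_map C Y W y"] A S(2) \<sigma>_apply y additive_presheaf_closed[OF aY A y]
        yoneda_arr_nat_trans[OF A] yoneda_map_nat_trans[OF aY A(2) y]
        yoneda_map_comp_yoneda_arr[OF aY A y] by simp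
  qed (auto simp: \<sigma>_def)
  moreover have "\<sigma> W ` carrier (on_obj Y W) = carrier (on_obj (restrict_yoneda C F) W)"
    if W: "W \<in> Obj C" for W
  proof (intro equalityI subsetI)
    fix z assume "z \<in> carrier (on_obj (restrict_yoneda C F) W)"
    then obtain t where t: "t \<in> nat_trans C (yoneda C W) Y" "z = \<pi> (yoneda C W) t"
      using surj[OF S(2)[OF W]] by auto
    have y: "t W (Ident C W) \<in> carrier (on_obj Y W)"
      using nat_trans_closed[OF t(1) W] ident_closed[OF W] by simp
    \<comment> \<open>By the Yoneda lemma \<open>t\<close> is the transformation attached to its
      value at the identity.\<close>
    have "\<sigma> W (t W (Ident C W)) = z"
      using \<sigma>_apply[OF W y] t(2) by (simp flip: yoneda_lemma[OF aY W t(1)])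
    then show "z \<in> \<sigma> W ` carrier (on_obj Y W)" using y by blast
  qed (use nat_trans_closed[OF \<sigma> W] in blast)
  moreover have "f W ` carrier (on_obj X W)
      = kernel (on_obj Y W) (on_obj (restrict_yoneda C F) W) (\<sigma> W)" if W: "W \<in> Obj C" for W
  proof -
    \<comment> \<open>Images under composition with \<open>f\<close> correspond to images under
      \<open>f W\<close>: a factorization \<open>t\<close> is evaluated at the identity, and
      conversely an element \<open>x\<close> gives the factorization
      \<open>yoneda_map C X W x\<close>.\<close>
    have "yoneda_map C Y W y \<in> yoneda_arr ?S X Y f (yoneda C W) ` nat_trans C (yoneda C W) X
        \<longleftrightarrow> y \<in> f W ` carrier (on_obj X W)" if y: "y \<in> carrier (on_obj Y W)" for y
    proof
      assume "yoneda_map C Y W y \<in> yoneda_arr ?S X Y f (yoneda C W) ` nat_trans C (yoneda C W) X"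
      then obtain t where t: "t \<in> nat_trans C (yoneda C W) X"
        and eq: "yoneda_map C Y W y = Comp (mod_cat C) (yoneda C W) X Y f t"
        using S(2)[OF W] by (auto simp: yoneda_arr_apply)
      have id: "Ident C W \<in> carrier (on_obj (yoneda C W) W)" using ident_closed[OF W] by simp
      have "y = f W (t W (Ident C W))"
        using mod_cat_comp_apply[OF W id, of X Y f t] yoneda_map_at_ident[OF aY W y] eq by simp
      then show "y \<in> f W ` carrier (on_obj X W)" using nat_trans_closed[OF t W id] by blast
    next
      assume "y \<in> f W ` carrier (on_obj X W)"
      then obtain x where x: "x \<in> carrier (on_obj X W)" "y = f W x" by blast
      have "yoneda_arr ?S X Y f (yoneda C W) (yoneda_map C X W x) = yoneda_map C Y W y"
        using comp_yoneda_map[OF aX aY W x(1) f] x(2) S(2)[OF W] yoneda_map_nat_trans[OF aX W x(1)]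
        by (simp add: yoneda_arr_apply)
      then show "yoneda_map C Y W y \<in> yoneda_arr ?S X Y f (yoneda C W) ` nat_trans C (yoneda C W) X"
        using yoneda_map_nat_trans[OF aX W x(1)] by (metis imageI)
    qed
    moreover have "y \<in> kernel (on_obj Y W) (on_obj (restrict_yoneda C F) W) (\<sigma> W)
        \<longleftrightarrow> y \<in> carrier (on_obj Y W) \<and>
          yoneda_map C Y W y \<in> kernel (Hom (mod_cat C) (yoneda C W) Y) (on_obj F (yoneda C W)) (\<pi> (yoneda C W))"
      for y
      using \<sigma>_apply[OF W] yoneda_map_nat_trans[OF aY W] by (auto simp: kernel_def)
    moreover have "f W ` carrier (on_obj X W) \<subseteq> carrier (on_obj Y W)"
      using nat_trans_closed[OF f W] by blast
    ultimately show ?thesis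
      unfolding exact[OF S(2)[OF W], symmetric] by (simp add: set_eq_iff subset_iff) metis
  qed
  ultimately show thesis by (rule that)
qed

end

section \<open>Admissible presentations and restriction to \<open>\<P>\<close>\<close>

theorem proposition4p32:
  fixes \<P> :: "('o, 'a) precat"
    and \<X> :: "('o, 'a, 'a) presheaf set"
  assumes "additive_category \<P>"
    and "abelian_category (mod_cat \<P>)"
    and "\<X> \<subseteq> Obj (mod_cat \<P>)"
    and "iso_closed (mod_cat \<P>) \<X>"
    and "extension_closed (mod_cat \<P>) \<X>"
    and "closed_under_kernels_of_epis (mod_cat \<P>) \<X>"
    and "representables \<P> \<subseteq> \<X>"
  shows "(mod_adm (full_subcat (mod_cat \<P>) \<X>) (inherited_exact_structure (mod_cat \<P>) \<X>)
           :: (('o, 'a, 'a) presheaf, 'o \<Rightarrow> 'a \<Rightarrow> 'a, 'v) presheaf set) =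
         {F \<in> fp_functors (full_subcat (mod_cat \<P>) \<X>).
            belongs_to \<P> (restrict_yoneda \<P> F) \<X>}"
proof -
  interpret additive_category \<P> by (rule assms(1))
  interpret M: abelian_category "mod_cat \<P>" by (rule assms(2))
  let ?S = "full_subcat (mod_cat \<P>) \<X>" and ?E = "inherited_exact_structure (mod_cat \<P>) \<X>"
  have fp: "\<X> \<subseteq> fp_functors \<P>" using assms(3) by simp
  have yon: "yoneda \<P> W \<in> \<X>" if "W \<in> Obj \<P>" for W
    using yoneda_representable[OF that] assms(7) by blast
  \<comment> \<open>Both sides of the theorem are cut out of \<open>fp_functors ?S\<close>, so the
    two defining conditions can be compared for a fixed \<open>F\<close>.\<close>
  have adm_iff: "(\<exists>X\<in>\<X>. \<exists>Y\<in>\<X>. \<exists>f\<in>nat_trans \<P> X Y. admissible ?S ?E X Y f \<and> presented_by ?S X Y f F)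
      \<longleftrightarrow> belongs_to \<P> (restrict_yoneda \<P> F) \<X>"
    if F: "F \<in> fp_functors ?S" for F :: "(('o, 'a, 'a) presheaf, 'o \<Rightarrow> 'a \<Rightarrow> 'a, 'v) presheaf"
  proof

    \<comment> \<open>Restriction of an admissibly presented functor\<close>
    note aF = restrict_yoneda_additive[OF yon fp_functors_additive[OF F]]
    assume "\<exists>X\<in>\<X>. \<exists>Y\<in>\<X>. \<exists>f\<in>nat_trans \<P> X Y. admissible ?S ?E X Y f \<and> presented_by ?S X Y f F"
    then obtain X Y f where X: "X \<in> \<X>" and Y: "Y \<in> \<X>" and f: "f \<in> nat_trans \<P> X Y"
      and adm: "admissible ?S ?E X Y f" and pres: "presented_by ?S X Y f F" by blast
    from adm obtain I p m K i Z r where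
      I: "I \<in> \<X>" and Z: "Z \<in> \<X>" and K: "K \<in> \<X>"
      and se1: "short_exact (mod_cat \<P>) K X I i p" and se2: "short_exact (mod_cat \<P>) I Y Z m r"
      and f_eq: "f = Comp (mod_cat \<P>) X I Y m p"
      unfolding admissible_def deflation_def inflation_def inherited_exact_structure_def by auto
    have fpX: "X \<in> fp_functors \<P>" and fpY: "Y \<in> fp_functors \<P>" and fpI: "I \<in> fp_functors \<P>"
      and fpZ: "Z \<in> fp_functors \<P>" and fpK: "K \<in> fp_functors \<P>" using X Y I Z K fp by auto
    \<comment> \<open>Both \<open>p\<close> and \<open>r\<close> are cokernels in their conflations,
      hence epimorphisms, hence surjective at every object since \<open>mod(\<P>)\<close> is
      abelian.\<close>
    have "is_epi (mod_cat \<P>) X I p" "is_epi (mod_cat \<P>) Y Z r"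
      using M.cokernel_is_epi[of K X i I p] M.cokernel_is_epi[of I Y m Z r] se1 se2 fpK fpX fpI fpY
      by (auto simp: short_exact_def)
    then have p_surj: "p W ` carrier (on_obj X W) = carrier (on_obj I W)"
      and r_surj: "r W ` carrier (on_obj Y W) = carrier (on_obj Z W)" if "W \<in> Obj \<P>" for W
      using epi_surjective[OF assms(2) fpX fpI _ that] epi_surjective[OF assms(2) fpY fpZ _ that]
      by blast+
    have r: "r \<in> nat_trans \<P> Y Z" and m_ker: "is_kernel (mod_cat \<P>) Y Z r I m"
      using se2 by (auto simp: short_exact_def is_kernel_def)
    obtain \<sigma> where \<sigma>: "\<sigma> \<in> nat_trans \<P> Y (restrict_yoneda \<P> F)"
      and \<sigma>_surj: "\<And>W. W \<in> Obj \<P> \<Longrightarrow>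
        \<sigma> W ` carrier (on_obj Y W) = carrier (on_obj (restrict_yoneda \<P> F) W)"
      and \<sigma>_ker: "\<And>W. W \<in> Obj \<P> \<Longrightarrow> f W ` carrier (on_obj X W)
        = kernel (on_obj Y W) (on_obj (restrict_yoneda \<P> F) W) (\<sigma> W)"
      using restrict_yoneda_cokernel[OF fp yon X Y f pres] by metis
    \<comment> \<open>As \<open>p\<close> is onto, \<open>f\<close> and \<open>m\<close> have the
      same image, which is the kernel of \<open>\<sigma>\<close> on one side and of \<open>r\<close>
      on the other. So the restriction and \<open>Z\<close> are the same quotient of
      \<open>Y\<close>.\<close>
    have "kernel (on_obj Y W) (on_obj (restrict_yoneda \<P> F) W) (\<sigma> W)
        = kernel (on_obj Y W) (on_obj Z W) (r W)" if W: "W \<in> Obj \<P>" for W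
    proof -
      have "f W ` carrier (on_obj X W) = m W ` p W ` carrier (on_obj X W)"
        unfolding image_image f_eq using W by (intro image_cong) (simp_all add: mod_cat_comp_apply)
      then show ?thesis
        using \<sigma>_ker[OF W] p_surj[OF W] kernel_pointwise(2)[OF fpY fpZ m_ker W] by simp
    qed
    then have "naturally_isomorphic \<P> (restrict_yoneda \<P> F) Z"
      using naturally_isomorphic_quotients[OF fp_functors_additive[OF fpY] aF
          fp_functors_additive[OF fpZ] \<sigma> r \<sigma>_surj r_surj] by simp
    then show "belongs_to \<P> (restrict_yoneda \<P> F) \<X>"
      using Z unfolding belongs_to_def by blast
  next

    \<comment> \<open>Admissibility when the restriction lies in \<open>\<X>\<close>\<close>
    note aF = restrict_yoneda_additive[OF yon fp_functors_additive[OF F]]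
    assume "belongs_to \<P> (restrict_yoneda \<P> F) \<X>"
    then obtain G \<eta> where G: "G \<in> \<X>" and \<eta>: "\<eta> \<in> nat_trans \<P> (restrict_yoneda \<P> F) G"
      and \<eta>_iso: "\<And>W. W \<in> Obj \<P> \<Longrightarrow> \<eta> W \<in> iso (on_obj (restrict_yoneda \<P> F) W) (on_obj G W)"
      unfolding belongs_to_def naturally_isomorphic_def by blast
    obtain X Y f where X: "X \<in> \<X>" and Y: "Y \<in> \<X>" and f: "f \<in> nat_trans \<P> X Y"
      and pres: "presented_by ?S X Y f F"
      using F unfolding fp_functors_def by auto
    have fpX: "X \<in> fp_functors \<P>" and fpY: "Y \<in> fp_functors \<P>" and fpG: "G \<in> fp_functors \<P>"
      using X Y G fp by auto
    note aX = fp_functors_additive[OF fpX] and aY = fp_functors_additive[OF fpY]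
      and aG = fp_functors_additive[OF fpG]
    obtain \<sigma> where \<sigma>: "\<sigma> \<in> nat_trans \<P> Y (restrict_yoneda \<P> F)"
      and \<sigma>_surj: "\<And>W. W \<in> Obj \<P> \<Longrightarrow>
        \<sigma> W ` carrier (on_obj Y W) = carrier (on_obj (restrict_yoneda \<P> F) W)"
      and \<sigma>_ker: "\<And>W. W \<in> Obj \<P> \<Longrightarrow> f W ` carrier (on_obj X W)
        = kernel (on_obj Y W) (on_obj (restrict_yoneda \<P> F) W) (\<sigma> W)"
      using restrict_yoneda_cokernel[OF fp yon X Y f pres] by metis
    \<comment> \<open>The composite of \<open>\<sigma>\<close> and \<open>\<eta>\<close> is written
      out because its middle term may take values in a type other than that of
      \<open>mod_cat \<P>\<close>.\<close>
    define q where "q = (\<lambda>W\<in>Obj \<P>. compose (carrier (on_obj Y W)) (\<eta> W) (\<sigma> W))"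
    have q: "q \<in> nat_trans \<P> Y G" unfolding q_def by (rule nat_trans_comp[OF aY \<sigma> \<eta>])
    have q_apply: "q W y = \<eta> W (\<sigma> W y)" if "W \<in> Obj \<P>" "y \<in> carrier (on_obj Y W)" for W y
      using that by (simp add: q_def compose_eq)
    have q_surj: "q W ` carrier (on_obj Y W) = carrier (on_obj G W)" if W: "W \<in> Obj \<P>" for W
    proof -
      have "q W ` carrier (on_obj Y W) = \<eta> W ` \<sigma> W ` carrier (on_obj Y W)"
        unfolding image_image using q_apply[OF W] by (intro image_cong) simp_all
      then show ?thesis using \<sigma>_surj[OF W] \<eta>_iso[OF W] by (simp add: iso_def bij_betw_def)
    qed
    \<comment> \<open>Injectivity of \<open>\<eta> W\<close> leaves the kernel of
      \<open>\<sigma> W\<close> unchanged.\<close>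
    have q_ker: "f W ` carrier (on_obj X W) = kernel (on_obj Y W) (on_obj G W) (q W)"
      if W: "W \<in> Obj \<P>" for W
    proof -
      have "q W y = \<one>\<^bsub>on_obj G W\<^esub> \<longleftrightarrow> \<sigma> W y = \<one>\<^bsub>on_obj (restrict_yoneda \<P> F) W\<^esub>"
        if y: "y \<in> carrier (on_obj Y W)" for y
      proof -
        have "inj_on (\<eta> W) (carrier (on_obj (restrict_yoneda \<P> F) W))"
          using \<eta>_iso[OF W] unfolding iso_def bij_betw_def by blast
        then show ?thesis
          using q_apply[OF W y] nat_trans_one[OF \<eta> aF aG W] nat_trans_closed[OF \<sigma> W y]
            comm_groupE(2)[OF additive_presheaf_group[OF aF W]] inj_on_eq_iff by metis
      qed
      then show ?thesis using \<sigma>_ker[OF W] by (auto simp: kernel_def)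
    qed
    obtain I m where m_ker: "is_kernel (mod_cat \<P>) Y G q I m"
      using M.kernels[of Y G q] fpY fpG q by auto
    have I: "I \<in> \<X>"
      using assms(6) Y G epi_if_surjective[OF fpY q q_surj] m_ker
      unfolding closed_under_kernels_of_epis_def by blast
    then have fpI: "I \<in> fp_functors \<P>" using fp by blast
    note aI = fp_functors_additive[OF fpI]
    have m: "m \<in> nat_trans \<P> I Y" using m_ker by (simp add: is_kernel_def)
    note m_inj = kernel_pointwise(1)[OF fpY fpG m_ker]
      and m_img = kernel_pointwise(2)[OF fpY fpG m_ker]
    \<comment> \<open>Since \<open>f\<close> lands in the kernel of \<open>q\<close>, it factors
      through \<open>m\<close>; this produces \<open>p\<close>.\<close>
    have "Comp (mod_cat \<P>) X Y G q f = Zero (mod_cat \<P>) X G"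
    proof (rule nat_trans_eqI[OF mod_cat_comp_closed[OF aX f q] mod_cat_zero_closed[OF aX aG]])
      fix W x assume W: "W \<in> Obj \<P>" and x: "x \<in> carrier (on_obj X W)"
      then have "f W x \<in> kernel (on_obj Y W) (on_obj G W) (q W)" using q_ker[OF W] by blast
      then show "Comp (mod_cat \<P>) X Y G q f W x = Zero (mod_cat \<P>) X G W x"
        using W x by (simp add: mod_cat_comp_apply mod_cat_zero_apply kernel_def)
    qed
    then obtain p where p: "p \<in> nat_trans \<P> X I" and f_eq: "Comp (mod_cat \<P>) X I Y m p = f"
      using m_ker fpX f unfolding is_kernel_def Obj_mod_cat Arr_mod_cat by blast
    have mp: "m W (p W x) = f W x" if "W \<in> Obj \<P>" "x \<in> carrier (on_obj X W)" for W x
      using mod_cat_comp_apply[OF that, of I Y m p] f_eq by simp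
    \<comment> \<open>The images of \<open>m W\<close> and \<open>f W\<close> both equal the kernel
      of \<open>q W\<close>, so \<open>m W z\<close> is some \<open>f W x\<close>, that is
      \<open>m W (p W x)\<close>; injectivity of \<open>m W\<close> gives
      \<open>z = p W x\<close>.\<close>
    have p_surj: "p W ` carrier (on_obj X W) = carrier (on_obj I W)" if W: "W \<in> Obj \<P>" for W
    proof (intro equalityI subsetI)
      fix z assume z: "z \<in> carrier (on_obj I W)"
      then obtain x where x: "x \<in> carrier (on_obj X W)" "m W z = f W x"
        using m_img[OF W] q_ker[OF W] by blast
      then have "z = p W x"
        using mp[OF W x(1)] m_inj[OF W] z nat_trans_closed[OF p W x(1)] by (metis inj_onD)
      then show "z \<in> p W ` carrier (on_obj X W)" using x(1) by blast
    qed (use nat_trans_closed[OF p W] in blast)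
    obtain K k where k_ker: "is_kernel (mod_cat \<P>) X I p K k"
      using M.kernels[of X I p] fpX fpI p by auto
    have K: "K \<in> \<X>"
      using assms(6) X I epi_if_surjective[OF fpX p p_surj] k_ker
      unfolding closed_under_kernels_of_epis_def by blast
    then have fpK: "K \<in> fp_functors \<P>" using fp by blast
    have k: "k \<in> nat_trans \<P> K X" using k_ker by (simp add: is_kernel_def)
    \<comment> \<open>Surjections with their kernels are short exact; as \<open>K\<close>,
      \<open>I\<close> and \<open>G\<close> also lie in \<open>\<X>\<close>, both sequences are
      conflations.\<close>
    have "is_cokernel (mod_cat \<P>) K X k I p"
      by (rule cokernel_if_exact[OF fpK fpX fpI k p p_surj kernel_pointwise(2)[OF fpX fpI k_ker]])
    moreover have "is_cokernel (mod_cat \<P>) I Y m G q"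
      by (rule cokernel_if_exact[OF fpI fpY fpG m q q_surj m_img])
    ultimately have "?E K X I k p" "?E I Y G m q"
      using K X I Y G fpX fpY k_ker m_ker
      by (simp_all add: inherited_exact_structure_def short_exact_def)
    then have "deflation ?E X I p" "inflation ?E I Y m"
      unfolding deflation_def inflation_def by blast+
    then have "admissible ?S ?E X Y f"
      unfolding admissible_def using I f_eq by auto
    then show "\<exists>X\<in>\<X>. \<exists>Y\<in>\<X>. \<exists>f\<in>nat_trans \<P> X Y. admissible ?S ?E X Y f \<and> presented_by ?S X Y f F"
      using X Y f pres by blast
  qed
  then show ?thesis unfolding mod_adm_def by auto
qed

end
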